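(* Let $\alpha\ge -\frac12$, $1\le p<\infty$, let $\phi:\mathbb{R}^+\to\mathbb{R}^+$ be a positive measurable function such that $\phi$ is almost decreasing and $r\mapsto r^{d_\alpha/p}\phi(r)$ is almost increasing, and let $\psi$ be a measurable function on $\mathbb{R}$ such that $$K_{\phi,\psi}:=\sup_{r>0}\frac{1}{\phi(r)}\int_{\mathbb{R}}\frac{|\psi(t)|}{|t|^{d_\alpha}}\,\phi\!\left(\frac{r}{|t|}\right)dt<\infty .$$ Then the Dunkl-type Hausdorff operator $\mathcal{H}_\psi^\alpha$ is bounded on the generalized Dunkl-type Morrey space $L^{p,\phi}(\mathbb{R},d\mu_\alpha)$, and for all $f\in L^{p,\phi}(\mathbb{R},d\mu_\alpha)$ $$\|\mathcal{H}_\psi^\alpha f\|_{L^{p,\phi}(\mathbb{R},d\mu_\alpha)}\le K_{\phi,\psi}\,\|f\|_{L^{p,\phi}(\mathbb{R},d\mu_\alpha)} .$$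
   Context: Notation: $d_\alpha=2\alpha+2$; $d\mu_\alpha(x)=A_\alpha|x|^{2\alpha+1}dx$ with $A_\alpha=(2^{\alpha+1}\Gamma(\alpha+1))^{-1}$; $B(0,r)=\,]-r,r[$ for $r>0$. A function $\theta:\,]0,\infty[\,\to\,]0,\infty[$ is almost increasing (almost decreasing) if there is $C>0$ with $\theta(r)\le C\theta(s)$ (resp. $\theta(r)\ge C\theta(s)$) for $r\le s$. Dunkl translation: put $W_\alpha(x,y,z)=(1-\sigma_{x,y,z}+\sigma_{z,x,y}+\sigma_{z,y,x})\,\kappa_\alpha(|x|,|y|,|z|)$, where $\sigma_{x,y,z}=\frac{x^2+y^2-z^2}{2xy}$ if $x,y\in\mathbb{R}\setminus\{0\}$ and $0$ otherwise, and $$\kappa_\alpha(|x|,|y|,|z|)=D_\alpha\frac{\big([(|x|+|y|)^2-z^2][z^2-(|x|-|y|)^2]\big)^{\alpha-\frac12}}{|xyz|^{2\alpha}}$$ if $|z|\in[\,||x|-|y||,\,|x|+|y|\,]$ and $0$ otherwise, with $D_\alpha=\frac{(\Gamma(\alpha+1))^2}{2^{\alpha-1}\sqrt{\pi}\,\Gamma(\alpha+\frac12)}$. Let $d\nu_{x,y}(z)=W_\alpha(x,y,z)\,d\mu_\alpha(z)$ if $x,y\ne0$, $\nu_{x,0}=\delta_x$, $\nu_{0,y}=\delta_y$. Then $\tau_x^\alpha f(y)=\int_{\mathbb{R}}f(z)\,d\nu_{x,y}(z)$ (for continuous $f$, and by the same formula for more general functions). For $\alpha=-\frac12$, $\tau_x^\alpha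 f(y)=f(x+y)$. Generalized Dunkl-type Morrey space: $L^{p,\phi}(\mathbb{R},d\mu_\alpha)$ is the class of locally $p$-integrable $f$ on $\mathbb{R}$ with $$\|f\|_{L^{p,\phi}(\mathbb{R},d\mu_\alpha)}:=\sup_{r>0,\,x\in\mathbb{R}}\frac{1}{\phi(r)}\left(\frac{1}{r^{d_\alpha}}\int_{B(0,r)}\tau_x^\alpha|f|^p(y)\,d\mu_\alpha(y)\right)^{1/p}<\infty .$$ Dunkl-type Hausdorff operator: $\mathcal{H}_\psi^\alpha f(x):=\int_{\mathbb{R}}\frac{\psi(t)}{|t|^{2\alpha+2}}f\!\left(\frac{x}{t}\right)dt$. *)

theory Defs
  imports "HOL-Analysis.Analysis"
begin

text \<open>Measurability is Lebesgue measurability throughout, and functions are complex valued.\<close>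

definition dunkl_dim :: "real \<Rightarrow> real" where
  "dunkl_dim \<alpha> = 2 * \<alpha> + 2"

definition dunkl_A :: "real \<Rightarrow> real" where
  "dunkl_A \<alpha> = 1 / (2 powr (\<alpha> + 1) * Gamma (\<alpha> + 1))"

definition dunkl_measure :: "real \<Rightarrow> real measure" where
  "dunkl_measure \<alpha> =
     density lebesgue (\<lambda>x. ennreal (dunkl_A \<alpha> * \<bar>x\<bar> powr (2 * \<alpha> + 1)))"

definition almost_increasing :: "(real \<Rightarrow> real) \<Rightarrow> bool" where
  "almost_increasing \<theta> \<longleftrightarrow> (\<exists>C>0. \<forall>r s. 0 < r \<and> r \<le> s \<longrightarrow> \<theta> r \<le> C * \<theta> s)"

definition almost_decreasing :: "(real \<Rightarrow> real) \<Rightarrow> bool" where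
  "almost_decreasing \<theta> \<longleftrightarrow> (\<exists>C>0. \<forall>r s. 0 < r \<and> r \<le> s \<longrightarrow> \<theta> r \<ge> C * \<theta> s)"

definition dunkl_sigma :: "real \<Rightarrow> real \<Rightarrow> real \<Rightarrow> real" where
  "dunkl_sigma x y z =
     (if x \<noteq> 0 \<and> y \<noteq> 0 then (x\<^sup>2 + y\<^sup>2 - z\<^sup>2) / (2 * x * y) else 0)"

definition dunkl_D :: "real \<Rightarrow> real" where
  "dunkl_D \<alpha> = (Gamma (\<alpha> + 1))\<^sup>2 / (2 powr (\<alpha> - 1) * sqrt pi * Gamma (\<alpha> + 1 / 2))"

text \<open>Only meaningful for \<open>\<alpha> > - 1 / 2\<close>. The conventions \<open>0 powr a = 0\<close> and \<open>a / 0 = 0\<close>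
  take effect only on null sets of \<open>z\<close> when \<open>x\<close> and \<open>y\<close> are nonzero.\<close>

definition dunkl_kappa :: "real \<Rightarrow> real \<Rightarrow> real \<Rightarrow> real \<Rightarrow> real" where
  "dunkl_kappa \<alpha> x y z =
     (if \<bar>z\<bar> \<in> {\<bar>\<bar>x\<bar> - \<bar>y\<bar>\<bar> .. \<bar>x\<bar> + \<bar>y\<bar>}
      then dunkl_D \<alpha> *
           ((((\<bar>x\<bar> + \<bar>y\<bar>)\<^sup>2 - z\<^sup>2) * (z\<^sup>2 - (\<bar>x\<bar> - \<bar>y\<bar>)\<^sup>2)) powr (\<alpha> - 1 / 2))
             / \<bar>x * y * z\<bar> powr (2 * \<alpha>)
      else 0)"

definition dunkl_W :: "real \<Rightarrow> real \<Rightarrow> real \<Rightarrow> real \<Rightarrow> real" where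
  "dunkl_W \<alpha> x y z =
     (1 - dunkl_sigma x y z + dunkl_sigma z x y + dunkl_sigma z y x)
       * dunkl_kappa \<alpha> \<bar>x\<bar> \<bar>y\<bar> \<bar>z\<bar>"

text \<open>The measure \<open>\<nu>\<^bsub>x,y\<^esub>\<close> is signed, so integration against it is spelled out: evaluation
  for the two point masses, and otherwise a Bochner integral with density \<^term>\<open>dunkl_W\<close>.
  For \<open>g\<close> locally integrable this integral exists for almost every \<open>y\<close>, for each \<open>x\<close>.\<close>

definition dunkl_translation :: "real \<Rightarrow> real \<Rightarrow> (real \<Rightarrow> real) \<Rightarrow> real \<Rightarrow> real" where
  "dunkl_translation \<alpha> x g y =
     (if \<alpha> = - 1 / 2 then g (x + y)
      else if y = 0 then g x
      else if x = 0 then g y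
      else (LINT z|dunkl_measure \<alpha>. g z * dunkl_W \<alpha> x y z))"

definition dunkl_locally_integrable :: "real \<Rightarrow> real \<Rightarrow> (real \<Rightarrow> complex) \<Rightarrow> bool" where
  "dunkl_locally_integrable \<alpha> p f \<longleftrightarrow>
     f \<in> borel_measurable lebesgue \<and>
     (\<forall>K. compact K \<longrightarrow> set_integrable (dunkl_measure \<alpha>) K (\<lambda>x. norm (f x) powr p))"

text \<open>Although \<^term>\<open>dunkl_translation\<close> does not preserve positivity pointwise, its integral over
  the symmetric interval \<open>ball 0 r\<close> does, so the base of the power \<open>1 / p\<close> is nonnegative
  whenever \<open>f\<close> is locally \<open>p\<close>-integrable.\<close>

definition dunkl_morrey_norm ::
    "real \<Rightarrow> real \<Rightarrow> (real \<Rightarrow> real) \<Rightarrow> (real \<Rightarrow> complex) \<Rightarrow> ennreal" where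
  "dunkl_morrey_norm \<alpha> p \<phi> f =
     (SUP (r, x) \<in> {0<..} \<times> UNIV.
        ennreal (1 / \<phi> r *
          (1 / r powr dunkl_dim \<alpha> *
            (LINT y:ball 0 r|dunkl_measure \<alpha>.
               dunkl_translation \<alpha> x (\<lambda>z. norm (f z) powr p) y)) powr (1 / p)))"

definition dunkl_morrey :: "real \<Rightarrow> real \<Rightarrow> (real \<Rightarrow> real) \<Rightarrow> (real \<Rightarrow> complex) set" where
  "dunkl_morrey \<alpha> p \<phi> =
     {f. dunkl_locally_integrable \<alpha> p f \<and> dunkl_morrey_norm \<alpha> p \<phi> f < \<infinity>}"

definition hausdorff_integrand ::
    "real \<Rightarrow> (real \<Rightarrow> complex) \<Rightarrow> (real \<Rightarrow> complex) \<Rightarrow> real \<Rightarrow> real \<Rightarrow> complex" where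
  "hausdorff_integrand \<alpha> \<psi> f x t =
     \<psi> t / of_real (\<bar>t\<bar> powr (2 * \<alpha> + 2)) * f (x / t)"

definition dunkl_hausdorff ::
    "real \<Rightarrow> (real \<Rightarrow> complex) \<Rightarrow> (real \<Rightarrow> complex) \<Rightarrow> real \<Rightarrow> complex" where
  "dunkl_hausdorff \<alpha> \<psi> f x = (LINT t|lebesgue. hausdorff_integrand \<alpha> \<psi> f x t)"

definition hausdorff_K ::
    "real \<Rightarrow> (real \<Rightarrow> real) \<Rightarrow> (real \<Rightarrow> complex) \<Rightarrow> ennreal" where
  "hausdorff_K \<alpha> \<phi> \<psi> =
     (SUP r\<in>{0<..}. ennreal (1 / \<phi> r) *
        (\<integral>\<^sup>+ t. ennreal (norm (\<psi> t) / \<bar>t\<bar> powr dunkl_dim \<alpha> * \<phi> (r / \<bar>t\<bar>)) \<partial>lebesgue))"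

end

theory Submission
  imports Defs
begin

text \<open>
  Fubini's theorem turns \<open>\<integral>\<^bsub>B(0,r)\<^esub> \<tau>\<^sub>x g d\<mu>\<close> into the integral of \<open>g\<close> against a density \<open>k\<^sub>x\<^sub>,\<^sub>r\<close>
  with respect to \<open>\<mu>\<close>. This density is nonnegative because \<open>B(0,r)\<close> is symmetric, and it satisfies
  \<open>k\<^sub>x\<^sub>,\<^sub>r (t z) = k\<^bsub>x/t, r/\<bar>t\<bar>\<^esub> (z)\<close>. Hence the Morrey norm is a supremum of weighted \<open>L\<^sup>p\<close> norms which the
  dilations \<open>f \<mapsto> f (\<cdot> / t)\<close> permute up to explicit factors, and the estimate is Minkowski's integral
  inequality in these weighted spaces. The weight for \<open>x = 0\<close> is the indicator of \<open>B(0,r)\<close>; it yields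
  the almost everywhere existence and the local \<open>p\<close>-integrability of the image.
\<close>

section \<open>Minkowski's integral inequality with a majorant\<close>

text \<open>The constant is exactly K because a dilation by \<open>t\<close> multiplies the weighted
  integral by |t|^d, with d = \<open>dunkl_dim \<alpha>\<close>, and this cancels the |t|^(-d) in
  the normalisation (r/|t|)^d that the dilated ball brings in. Only the ratio of phi(r/|t|) to
  phi(r) survives, and integrating it against |psi(t)| / |t|^d gives the supremum that defines K.

  The obstacle is analytic bookkeeping. The translation has a signed kernel, and Bochner integrals
  silently take the value 0 when they diverge, so Fubini and every use of the norm need absolute
  integrability beforehand. It rests on one estimate: the integral of kappa(x,y,z) in y is bounded
  by a constant independent of z and of x \<noteq> 0. Together with |W| \<le> 4 kappa and the
  support condition |z| \<le> |x| + |y| it makes local integrability of g sufficient. Joint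
  measurability is secured by replacing f, psi and phi with Borel representatives; these agree only
  almost everywhere, so null sets must be followed through the map t -> x/t.\<close>

text \<open>The inner integral of the Minkowski inequality may be infinite before the estimate is
  known; the power keeps that value infinite instead of sending it to a default real.\<close>

definition ennreal_powr :: "real \<Rightarrow> ennreal \<Rightarrow> ennreal" where
  "ennreal_powr p u = (if u = \<infinity> then \<infinity> else ennreal (enn2real u powr p))"

lemma ennreal_powr_measurable [measurable (raw)]:
  "f \<in> borel_measurable M \<Longrightarrow> (\<lambda>x. ennreal_powr p (f x)) \<in> borel_measurable M"
  unfolding ennreal_powr_def by simp

text \<open>This is the tangent at 1 of the convex function \<open>v powr p\<close>, evaluated at
  \<open>v = u / s\<close> and multiplied by \<open>s powr p\<close>. The point \<open>u = 0\<close>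
  is separate because convexity is used on the open half-line.\<close>

lemma powr_tangent_line:
  fixes s u p :: real
  assumes "1 \<le> p" "0 < s" "0 \<le> u"
  shows "p * s powr (p - 1) * u \<le> u powr p + (p - 1) * s powr p"
proof (cases "u = 0")
  case True
  then show ?thesis using assms by simp
next
  case False
  then have u: "u > 0" using assms by simp
  have "1 + p * (u / s - 1) \<le> (u / s) powr p"
  proof -
    have "convex_on {0<..} (\<lambda>x::real. x powr p)"
      using powr_convex[OF assms(1)] .
    moreover have "((\<lambda>x::real. x powr p) has_real_derivative p * 1 powr (p - 1)) (at 1)"
      by (auto intro!: derivative_eq_intros)
    ultimately have "(u/s) powr p - 1 powr p \<ge> (p * 1 powr (p - 1)) * (u/s - 1)"
      using u assms by (intro convex_on_imp_above_tangent[where A="{0<..}"])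
        (auto simp: has_field_derivative_at_within interior_open)
    then show ?thesis by simp
  qed
  then have "s powr p * (1 + p * (u / s - 1)) \<le> s powr p * (u / s) powr p"
    by (intro mult_left_mono) auto
  moreover have "s powr p * (u / s) powr p = u powr p"
    using u assms by (simp add: powr_divide)
  moreover have "s powr p = s powr (p - 1) * s"
    using assms by (simp add: powr_diff)
  then have "s powr p * (1 + p * (u / s - 1)) = p * s powr (p - 1) * u - (p - 1) * s powr p"
    using assms by (simp add: field_simps)
  ultimately show ?thesis by linarith
qed

text \<open>Integrating the tangent line at \<open>s\<close> against \<open>c\<close> gives one
  bound for each \<open>s > 0\<close>; a good choice of \<open>s\<close> yields the claim.
  \<open>C\<close> need only dominate the mass of \<open>c\<close>, since the mass enters with the
  nonnegative coefficient \<open>(p - 1) * s powr p\<close>.\<close>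

lemma nn_integral_Jensen_powr:
  fixes u c :: "'a \<Rightarrow> real"
  assumes p: "1 \<le> p" and [measurable]: "u \<in> borel_measurable N" "c \<in> borel_measurable N"
    and nn: "\<And>t. 0 \<le> u t" "\<And>t. 0 \<le> c t"
    and C: "0 < C" "(\<integral>\<^sup>+t. ennreal (c t) \<partial>N) \<le> ennreal C"
  shows "ennreal_powr p (\<integral>\<^sup>+t. ennreal (u t * c t) \<partial>N)
           \<le> ennreal (C powr (p - 1)) * (\<integral>\<^sup>+t. ennreal (u t powr p * c t) \<partial>N)"
proof -
  define U where "U = (\<integral>\<^sup>+t. ennreal (u t * c t) \<partial>N)"
  define V where "V = (\<integral>\<^sup>+t. ennreal (u t powr p * c t) \<partial>N)"
  have tangent: "ennreal (p * s powr (p - 1)) * U \<le> V + ennreal ((p - 1) * s powr p * C)" if "0 < s" for s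
  proof -
    have "ennreal (p * s powr (p - 1)) * U = (\<integral>\<^sup>+t. ennreal (p * s powr (p - 1) * u t * c t) \<partial>N)"
      unfolding U_def using p nn
      by (subst nn_integral_cmult[symmetric]) (auto simp: ennreal_mult'[symmetric] mult_ac intro!: nn_integral_cong)
    also have "\<dots> \<le> (\<integral>\<^sup>+t. ennreal (u t powr p * c t) + ennreal ((p - 1) * s powr p) * ennreal (c t) \<partial>N)"
    proof (intro nn_integral_mono)
      fix t
      have "p * s powr (p - 1) * u t * c t \<le> (u t powr p + (p - 1) * s powr p) * c t"
        using powr_tangent_line[OF p that nn(1)] nn by (intro mult_right_mono) auto
      then show "ennreal (p * s powr (p - 1) * u t * c t)
          \<le> ennreal (u t powr p * c t) + ennreal ((p - 1) * s powr p) * ennreal (c t)"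
        using p nn by (subst ennreal_mult[symmetric], simp, simp, subst ennreal_plus[symmetric])
          (auto simp: distrib_right intro!: ennreal_leI simp del: ennreal_plus)
    qed
    also have "\<dots> = V + ennreal ((p - 1) * s powr p) * (\<integral>\<^sup>+t. ennreal (c t) \<partial>N)"
      unfolding V_def by (subst nn_integral_add) (auto simp: nn_integral_cmult)
    also have "\<dots> \<le> V + ennreal ((p - 1) * s powr p) * ennreal C"
      using C by (intro add_left_mono mult_left_mono) auto
    also have "\<dots> = V + ennreal ((p - 1) * s powr p * C)"
      using p C by (simp add: ennreal_mult'')
    finally show ?thesis .
  qed
  show ?thesis
  proof (cases "V = \<infinity>")
    case True
    then show ?thesis using C by (simp add: V_def[symmetric] ennreal_mult_top)
  next
    case False
    then obtain v where v: "V = ennreal v" "0 \<le> v" by (cases V) auto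
    have "U \<noteq> \<infinity>"
    proof
      assume "U = \<infinity>"
      \<comment> \<open>The tangent at \<open>s = 1\<close> already shows that a finite
        \<open>V\<close> forces a finite \<open>U\<close>.\<close>
      with tangent[of 1] p v show False by (simp add: ennreal_mult_top top_unique)
    qed
    then obtain u' where u': "U = ennreal u'" "0 \<le> u'" by (cases U) auto
    have "u' powr p \<le> C powr (p - 1) * v"
    proof (cases "u' = 0")
      case True
      then show ?thesis using v by simp
    next
      case False
      \<comment> \<open>The mean of \<open>u\<close> when the mass is counted as \<open>C\<close>.
        With it both tangent terms become multiples of \<open>s powr (p - 1) * u'\<close>, with
        coefficients \<open>p\<close> and \<open>p - 1\<close>, so exactly one copy remains.\<close>
      define s where "s = u' / C"
      have s: "0 < s" using False u' C by (simp add: s_def)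
      have "p * s powr (p - 1) * u' \<le> v + (p - 1) * s powr p * C"
        using tangent[OF s] unfolding v u' using p v u' C
        by (subst (asm) ennreal_mult[symmetric], simp, simp, subst (asm) ennreal_plus[symmetric])
          (auto simp del: ennreal_plus)
      moreover have "s powr p * C = s powr (p - 1) * u'"
        using C s False u' by (simp add: powr_diff s_def)
      then have "(p - 1) * s powr p * C = (p - 1) * (s powr (p - 1) * u')"
        by (simp only: mult.assoc)
      ultimately have "s powr (p - 1) * u' \<le> v"
        by (simp add: algebra_simps)
      moreover have "C powr (p - 1) * (s powr (p - 1) * u') = u' powr p"
        using C u' False by (simp add: s_def powr_divide powr_diff)
      ultimately show ?thesis
        by (metis mult_left_mono powr_ge_zero)
    qed
    then show ?thesis
      unfolding U_def[symmetric] V_def[symmetric] using v u'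
      by (simp add: ennreal_powr_def ennreal_mult'[symmetric] ennreal_leI)
  qed
qed

text \<open>Jensen's inequality is applied to \<open>F x t / c t\<close> with respect to \<open>c t dt\<close>. A majorant \<open>c\<close> of the norms is
  enough, so neither their measurability in \<open>t\<close> nor the finiteness of the left-hand side matters.\<close>

lemma Minkowski_integral_majorant:
  fixes F :: "'a \<Rightarrow> 'b \<Rightarrow> real" and c :: "'b \<Rightarrow> real"
  assumes "sigma_finite_measure M" "sigma_finite_measure N"
    and p: "1 \<le> p"
    and [measurable]: "case_prod F \<in> borel_measurable (M \<Otimes>\<^sub>M N)" "c \<in> borel_measurable N"
    and nn: "\<And>x t. 0 \<le> F x t" "\<And>t. 0 \<le> c t"
    and zero: "\<And>x t. c t = 0 \<Longrightarrow> F x t = 0"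
    and bound: "AE t in N. (\<integral>\<^sup>+x. ennreal (F x t powr p) \<partial>M) \<le> ennreal (c t powr p)"
    and C: "0 < C" "(\<integral>\<^sup>+t. ennreal (c t) \<partial>N) \<le> ennreal C"
  shows "(\<integral>\<^sup>+x. ennreal_powr p (\<integral>\<^sup>+t. ennreal (F x t) \<partial>N) \<partial>M) \<le> ennreal (C powr p)"
proof -
  interpret M: sigma_finite_measure M by fact
  interpret N: sigma_finite_measure N by fact
  interpret pair_sigma_finite M N ..
  define V where "V x = (\<integral>\<^sup>+t. ennreal ((F x t / c t) powr p * c t) \<partial>N)" for x
  \<comment> \<open>Where \<open>c t = 0\<close> the quotient is 0 by convention, and
    \<open>zero\<close> makes the right-hand side vanish as well.\<close>
  have F: "F x t / c t * c t = F x t" for x t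
    using zero by auto
  have "ennreal_powr p (\<integral>\<^sup>+t. ennreal (F x t) \<partial>N) \<le> ennreal (C powr (p - 1)) * V x" if "x \<in> space M" for x
  proof -
    have [measurable]: "F x \<in> borel_measurable N"
      using that by measurable
    have "ennreal_powr p (\<integral>\<^sup>+t. ennreal (F x t / c t * c t) \<partial>N) \<le> ennreal (C powr (p - 1)) * V x"
      unfolding V_def using nn by (intro nn_integral_Jensen_powr p C) auto
    then show ?thesis unfolding F .
  qed
  then have "(\<integral>\<^sup>+x. ennreal_powr p (\<integral>\<^sup>+t. ennreal (F x t) \<partial>N) \<partial>M)
      \<le> (\<integral>\<^sup>+x. ennreal (C powr (p - 1)) * V x \<partial>M)"
    by (intro nn_integral_mono)
  also have "\<dots> = ennreal (C powr (p - 1)) * (\<integral>\<^sup>+x. V x \<partial>M)"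
    unfolding V_def by (intro nn_integral_cmult) measurable
  also have "(\<integral>\<^sup>+x. V x \<partial>M) = (\<integral>\<^sup>+t. (\<integral>\<^sup>+x. ennreal ((F x t / c t) powr p * c t) \<partial>M) \<partial>N)"
    unfolding V_def by (intro Fubini'[symmetric]) measurable
  \<comment> \<open>For fixed \<open>t\<close> the inner integral is \<open>c t / c t powr p\<close>
    times that of \<open>F x t powr p\<close>, so \<open>bound\<close> leaves at most
    \<open>c t\<close>.\<close>
  also have "\<dots> \<le> (\<integral>\<^sup>+t. ennreal (c t) \<partial>N)"
  proof (rule nn_integral_mono_AE, use bound AE_space in eventually_elim)
    case (elim t)
    show ?case
    proof (cases "c t = 0")
      case False
      then have c: "c t > 0" using nn(2)[of t] by linarith
      have [measurable]: "(\<lambda>x. F x t) \<in> borel_measurable M" using elim(2) by measurable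
      have "(\<integral>\<^sup>+x. ennreal ((F x t / c t) powr p * c t) \<partial>M)
          = (\<integral>\<^sup>+x. ennreal (c t / c t powr p) * ennreal (F x t powr p) \<partial>M)"
        using c nn by (intro nn_integral_cong) (simp add: powr_divide ennreal_mult'[symmetric])
      also have "\<dots> = ennreal (c t / c t powr p) * (\<integral>\<^sup>+x. ennreal (F x t powr p) \<partial>M)"
        by (intro nn_integral_cmult) measurable
      also have "\<dots> \<le> ennreal (c t / c t powr p) * ennreal (c t powr p)"
        using elim by (intro mult_left_mono) auto
      also have "\<dots> = ennreal (c t)"
        using c by (simp add: ennreal_mult'[symmetric])
      finally show ?thesis .
    qed simp
  qed
  also have "\<dots> \<le> ennreal C" by fact
  also have "ennreal (C powr (p - 1)) * ennreal C = ennreal (C powr p)"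
    using C by (simp add: ennreal_mult'[symmetric] powr_diff)
  finally show ?thesis
    by (simp add: mult_left_mono)
qed

section \<open>The Dunkl measure and null sets\<close>

text \<open>The version on Borel sets: jointly Borel functions are measurable for its products, so
  Fubini applies directly, and \<open>dunkl_measure\<close> is its completion.\<close>

definition dunkl_borel :: "real \<Rightarrow> real measure" where
  "dunkl_borel \<alpha> = density lborel (\<lambda>x. ennreal (dunkl_A \<alpha> * \<bar>x\<bar> powr (2 * \<alpha> + 1)))"

lemma space_dunkl_borel [simp]: "space (dunkl_borel \<alpha>) = UNIV"
  by (simp add: dunkl_borel_def)

lemma sets_dunkl_borel [simp, measurable_cong]: "sets (dunkl_borel \<alpha>) = sets borel"
  by (simp add: dunkl_borel_def)

lemma sigma_finite_dunkl_borel: "sigma_finite_measure (dunkl_borel \<alpha>)"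
  unfolding dunkl_borel_def
  by (subst sigma_finite_measure.sigma_finite_iff_density_finite[OF sigma_finite_lborel]) auto

lemma dunkl_A_pos: "\<alpha> > - 1 \<Longrightarrow> 0 < dunkl_A \<alpha>"
  by (simp add: dunkl_A_def)

text \<open>The density is positive off the origin, so weighting creates no new null sets and
  commutes with completion. The bound on \<alpha> keeps the Gamma factor positive.\<close>

lemma dunkl_measure_eq_completion:
  assumes "\<alpha> > - 1"
  shows "dunkl_measure \<alpha> = completion (dunkl_borel \<alpha>)"
  unfolding dunkl_measure_def dunkl_borel_def
proof (intro completion_density_eq[symmetric])
  show "AE x in lborel. 0 < ennreal (dunkl_A \<alpha> * \<bar>x\<bar> powr (2 * \<alpha> + 1))"
    using AE_lborel_singleton[of 0] by eventually_elim (use dunkl_A_pos[OF assms] in auto)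
qed simp

lemma AE_dunkl_borel_iff:
  assumes "\<alpha> > - 1"
  shows "(AE x in dunkl_borel \<alpha>. P x) \<longleftrightarrow> (AE x in lborel. P x)"
proof -
  have "(AE x in dunkl_borel \<alpha>. P x) \<longleftrightarrow>
      (AE x in lborel. 0 < ennreal (dunkl_A \<alpha> * \<bar>x\<bar> powr (2 * \<alpha> + 1)) \<longrightarrow> P x)"
    unfolding dunkl_borel_def by (subst AE_density) auto
  also have "\<dots> \<longleftrightarrow> (AE x in lborel. P x)"
  proof (rule eventually_cong)
    show "AE x in lborel. x \<noteq> (0::real)" by (rule AE_lborel_singleton)
  qed (use dunkl_A_pos[OF assms] in auto)
  finally show ?thesis .
qed

lemma nn_integral_dunkl_borel:
  assumes [measurable]: "f \<in> borel_measurable borel"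
  shows "(\<integral>\<^sup>+x. f x \<partial>dunkl_borel \<alpha>) = (\<integral>\<^sup>+x. ennreal (dunkl_A \<alpha> * \<bar>x\<bar> powr (2 * \<alpha> + 1)) * f x \<partial>lborel)"
  unfolding dunkl_borel_def by (subst nn_integral_density) auto

text \<open>Lebesgue measure contributes one factor |t| and the weight contributes
  |t|^(2\<alpha>+1).\<close>

lemma nn_integral_dunkl_borel_scale:
  assumes [measurable]: "f \<in> borel_measurable borel" and t: "t \<noteq> 0" and a: "\<alpha> > - 1"
  shows "(\<integral>\<^sup>+x. f x \<partial>dunkl_borel \<alpha>) = ennreal (\<bar>t\<bar> powr dunkl_dim \<alpha>) * (\<integral>\<^sup>+x. f (t * x) \<partial>dunkl_borel \<alpha>)"
proof -
  have dim: "\<bar>t\<bar> powr dunkl_dim \<alpha> = \<bar>t\<bar> * \<bar>t\<bar> powr (2 * \<alpha> + 1)"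
    using t powr_mult_base[of "\<bar>t\<bar>" "2 * \<alpha> + 1"] by (simp add: dunkl_dim_def add.commute)
  have "(\<integral>\<^sup>+x. f x \<partial>dunkl_borel \<alpha>) =
      ennreal \<bar>t\<bar> * (\<integral>\<^sup>+x. ennreal (dunkl_A \<alpha> * \<bar>t * x\<bar> powr (2 * \<alpha> + 1)) * f (t * x) \<partial>lborel)"
    using t by (simp add: nn_integral_dunkl_borel, subst nn_integral_real_affine[where c=t and t=0]) auto
  also have "(\<integral>\<^sup>+x. ennreal (dunkl_A \<alpha> * \<bar>t * x\<bar> powr (2 * \<alpha> + 1)) * f (t * x) \<partial>lborel) =
     (\<integral>\<^sup>+x. ennreal (\<bar>t\<bar> powr (2 * \<alpha> + 1)) * (ennreal (dunkl_A \<alpha> * \<bar>x\<bar> powr (2 * \<alpha> + 1)) * f (t * x)) \<partial>lborel)"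
    using dunkl_A_pos[OF a]
    by (intro nn_integral_cong) (simp add: abs_mult powr_mult ennreal_mult mult_ac)
  also have "\<dots> = ennreal (\<bar>t\<bar> powr (2 * \<alpha> + 1)) * (\<integral>\<^sup>+x. f (t * x) \<partial>dunkl_borel \<alpha>)"
    by (subst nn_integral_cmult) (auto simp: nn_integral_dunkl_borel)
  finally show ?thesis by (simp add: dim ennreal_mult mult.assoc)
qed

lemma dunkl_borel_reflect: "distr (dunkl_borel \<alpha>) borel uminus = dunkl_borel \<alpha>"
proof (rule measure_eqI)
  fix X assume "X \<in> sets (distr (dunkl_borel \<alpha>) borel uminus)"
  then have [measurable]: "X \<in> sets borel" by simp
  have "emeasure (distr (dunkl_borel \<alpha>) borel uminus) X = (\<integral>\<^sup>+x. indicator X (- x) \<partial>dunkl_borel \<alpha>)"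
    by (subst nn_integral_indicator[symmetric], simp, subst nn_integral_distr) auto
  also have "\<dots> = (\<integral>\<^sup>+x. indicator X x \<partial>dunkl_borel \<alpha>)"
    unfolding nn_integral_dunkl_borel[OF borel_measurable_indicator[OF \<open>X \<in> sets borel\<close>]]
    by (subst nn_integral_real_affine[where c="-1" and t=0]) (simp_all add: nn_integral_dunkl_borel)
  finally show "emeasure (distr (dunkl_borel \<alpha>) borel uminus) X = emeasure (dunkl_borel \<alpha>) X"
    by simp
qed simp

section \<open>Completions, Borel representatives and null sets\<close>

lemma measurable_completion_AE:
  assumes g: "g \<in> borel_measurable M" and ae: "AE x in M. f x = g x"
  shows "f \<in> borel_measurable (completion M)"
proof (rule measurableI)
  fix A :: "'b set" assume "A \<in> sets borel"
  then have meas: "g -` A \<inter> space (completion M) \<in> sets (completion M)"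
    by (intro measurable_sets[OF measurable_completion[OF g]])
  have "AE x in completion M. x \<in> g -` A \<inter> space (completion M) \<longleftrightarrow> x \<in> f -` A \<inter> space (completion M)"
    using AE_completion[OF ae] by eventually_elim simp
  from completion.in_sets_AE[OF this meas]
  show "f -` A \<inter> space (completion M) \<in> sets (completion M)" by simp
qed simp

text \<open>No integrability is assumed: functions equal almost everywhere also share the default
  value 0 of a divergent integral.\<close>

lemma integral_completion_AE:
  fixes f g :: "'a \<Rightarrow> 'b::{banach, second_countable_topology}"
  assumes g: "g \<in> borel_measurable M" and ae: "AE x in M. f x = g x"
  shows "integral\<^sup>L (completion M) f = integral\<^sup>L M g"
proof -
  have "integral\<^sup>L (completion M) f = integral\<^sup>L (completion M) g"
    using measurable_completion_AE[OF g ae] measurable_completion[OF g] AE_completion[OF ae]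
    by (intro integral_cong_AE)
  then show ?thesis using integral_completion[OF g] by simp
qed

lemma lebesgue_ex_borel:
  fixes f :: "real \<Rightarrow> complex"
  assumes [measurable]: "f \<in> borel_measurable lebesgue"
  obtains f' where "f' \<in> borel_measurable borel" "AE x in lborel. f x = f' x"
proof -
  obtain g where g: "g \<in> borel_measurable lborel" "AE x in lborel. Re (f x) = g x"
    using completion_ex_borel_measurable_real[of "\<lambda>x. Re (f x)" lborel] by auto
  obtain h where h: "h \<in> borel_measurable lborel" "AE x in lborel. Im (f x) = h x"
    using completion_ex_borel_measurable_real[of "\<lambda>x. Im (f x)" lborel] by auto
  show ?thesis
  proof
    show "(\<lambda>x. Complex (g x) (h x)) \<in> borel_measurable borel"
      using g h by (simp add: borel_measurable_complex_iff)
    show "AE x in lborel. f x = Complex (g x) (h x)"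
      using g(2) h(2) by eventually_elim (simp add: complex_eq_iff)
  qed
qed

text \<open>The map y -> x/y is its own inverse off 0 and differentiable there, so it carries the
  exceptional set of \<open>P\<close> to a negligible set; 0 is added to that set by hand.\<close>

lemma AE_lborel_divide:
  assumes "AE y in lborel. P y" and x: "x \<noteq> (0::real)"
  shows "AE t in lborel. P (x / t)"
proof -
  have "{y. \<not> P y} \<in> null_sets lebesgue"
    using AE_completion[OF assms(1)] by (simp add: completion.AE_iff_null_sets)
  then have N: "negligible {y. \<not> P y}" by (simp add: negligible_iff_null_sets)
  have "negligible ((\<lambda>y. x / y) ` ({y. \<not> P y} - {0}))"
  proof (rule negligible_differentiable_image_negligible)
    show "negligible ({y. \<not> P y} - {0})" using N by (rule negligible_diff)
    show "(\<lambda>y. x / y) differentiable_on {y. \<not> P y} - {0}"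
      by (auto simp: differentiable_on_def intro!: field_differentiable_imp_differentiable
          field_differentiable_divide field_differentiable_const field_differentiable_ident)
  qed simp
  then have "negligible (insert 0 ((\<lambda>y. x / y) ` ({y. \<not> P y} - {0})))" by simp
  then have "AE t in lebesgue. t \<notin> insert 0 ((\<lambda>y. x / y) ` ({y. \<not> P y} - {0}))"
    unfolding negligible_iff_null_sets by (rule AE_not_in)
  then have "AE t in lebesgue. P (x / t)"
  proof eventually_elim
    case (elim t)
    then have "t \<noteq> 0" by auto
    then have t: "t = x / (x / t)" "x / t \<noteq> 0" using x by simp_all
    show ?case
    proof (rule ccontr)
      assume "\<not> P (x / t)"
      then have "t \<in> (\<lambda>y. x / y) ` ({y. \<not> P y} - {0})"
        using t(2) by (intro image_eqI[where x="x / t"] t(1)) simp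
      then show False using elim by blast
    qed
  qed
  then show ?thesis by (simp add: AE_completion_iff)
qed

section \<open>The kernel of the Dunkl translation\<close>

lemma dunkl_kappa_abs [simp]:
  "dunkl_kappa \<alpha> \<bar>x\<bar> y z = dunkl_kappa \<alpha> x y z"
  "dunkl_kappa \<alpha> x \<bar>y\<bar> z = dunkl_kappa \<alpha> x y z"
  "dunkl_kappa \<alpha> x y \<bar>z\<bar> = dunkl_kappa \<alpha> x y z"
  by (simp_all add: dunkl_kappa_def abs_mult)

lemma dunkl_kappa_minus [simp]: "dunkl_kappa \<alpha> x (- y) z = dunkl_kappa \<alpha> x y z"
  by (simp add: dunkl_kappa_def)

lemma dunkl_D_nonneg: "\<alpha> > - 1 / 2 \<Longrightarrow> 0 \<le> dunkl_D \<alpha>"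
  by (auto simp: dunkl_D_def intro!: divide_nonneg_nonneg mult_nonneg_nonneg less_imp_le[OF Gamma_real_pos])

lemma dunkl_kappa_nonneg: "\<alpha> > - 1 / 2 \<Longrightarrow> 0 \<le> dunkl_kappa \<alpha> x y z"
  using dunkl_D_nonneg by (simp add: dunkl_kappa_def)

lemma dunkl_sigma_measurable [measurable (raw)]:
  assumes [measurable]: "f \<in> borel_measurable M" "g \<in> borel_measurable M" "h \<in> borel_measurable M"
  shows "(\<lambda>t. dunkl_sigma (f t) (g t) (h t)) \<in> borel_measurable M"
  unfolding dunkl_sigma_def by measurable

lemma dunkl_kappa_measurable [measurable (raw)]:
  assumes [measurable]: "f \<in> borel_measurable M" "g \<in> borel_measurable M" "h \<in> borel_measurable M"
  shows "(\<lambda>t. dunkl_kappa \<alpha> (f t) (g t) (h t)) \<in> borel_measurable M"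
  unfolding dunkl_kappa_def atLeastAtMost_iff by measurable

lemma dunkl_W_measurable [measurable (raw)]:
  assumes [measurable]: "f \<in> borel_measurable M" "g \<in> borel_measurable M" "h \<in> borel_measurable M"
  shows "(\<lambda>t. dunkl_W \<alpha> (f t) (g t) (h t)) \<in> borel_measurable M"
  unfolding dunkl_W_def dunkl_kappa_abs by measurable

text \<open>By the law of cosines this is, up to sign, the cosine of an angle in a triangle with
  sides |x|, |y|, |z|; the assumptions are the triangle inequalities.\<close>

lemma dunkl_sigma_le_1:
  assumes "\<bar>\<bar>x\<bar> - \<bar>y\<bar>\<bar> \<le> \<bar>z\<bar>" "\<bar>z\<bar> \<le> \<bar>x\<bar> + \<bar>y\<bar>"
  shows "\<bar>dunkl_sigma x y z\<bar> \<le> 1"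
proof (cases "x \<noteq> 0 \<and> y \<noteq> 0")
  case True
  have "(\<bar>x\<bar> - \<bar>y\<bar>)\<^sup>2 \<le> z\<^sup>2" "z\<^sup>2 \<le> (\<bar>x\<bar> + \<bar>y\<bar>)\<^sup>2"
    using assms by (simp_all add: abs_le_square_iff[symmetric])
  then have "\<bar>x\<^sup>2 + y\<^sup>2 - z\<^sup>2\<bar> \<le> 2 * \<bar>x\<bar> * \<bar>y\<bar>"
    by (simp add: power2_diff power2_sum abs_le_iff)
  then show ?thesis
    using True by (simp add: dunkl_sigma_def abs_mult)
qed (auto simp: dunkl_sigma_def)

lemma dunkl_kappa_support:
  assumes "dunkl_kappa \<alpha> x y z \<noteq> 0"
  shows "\<bar>\<bar>x\<bar> - \<bar>y\<bar>\<bar> \<le> \<bar>z\<bar>" "\<bar>z\<bar> \<le> \<bar>x\<bar> + \<bar>y\<bar>"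
  using assms by (auto simp: dunkl_kappa_def split: if_splits)

text \<open>The support of \<open>dunkl_kappa\<close> is cut out by the triangle inequalities, which
  are symmetric in the three lengths and hence control all three cosines.\<close>

lemma dunkl_sigma_le_1_support:
  assumes "dunkl_kappa \<alpha> x y z \<noteq> 0"
  shows "\<bar>dunkl_sigma x y z\<bar> \<le> 1" "\<bar>dunkl_sigma z x y\<bar> \<le> 1" "\<bar>dunkl_sigma z y x\<bar> \<le> 1"
  using dunkl_kappa_support[OF assms] by (intro dunkl_sigma_le_1; linarith)+

lemma dunkl_W_abs_le:
  assumes "\<alpha> > - 1 / 2"
  shows "\<bar>dunkl_W \<alpha> x y z\<bar> \<le> 4 * dunkl_kappa \<alpha> x y z"
proof (cases "dunkl_kappa \<alpha> x y z = 0")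
  case False
  from dunkl_sigma_le_1_support[OF this]
  have "\<bar>1 - dunkl_sigma x y z + dunkl_sigma z x y + dunkl_sigma z y x\<bar> \<le> 4" by linarith
  then show ?thesis
    using dunkl_kappa_nonneg[OF assms] by (simp add: dunkl_W_def abs_mult mult_right_mono)
qed (simp add: dunkl_W_def)

lemma dunkl_W_symmetrized:
  "dunkl_W \<alpha> x y z + dunkl_W \<alpha> x (- y) z = 2 * ((1 + dunkl_sigma z x y) * dunkl_kappa \<alpha> x y z)"
proof -
  have "dunkl_sigma x (- y) z = - dunkl_sigma x y z" "dunkl_sigma z (- y) x = - dunkl_sigma z y x"
    "dunkl_sigma z x (- y) = dunkl_sigma z x y"
    by (simp_all add: dunkl_sigma_def)
  then show ?thesis by (simp add: dunkl_W_def algebra_simps)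
qed

lemma dunkl_kappa_weight_nonneg:
  assumes "\<alpha> > - 1 / 2"
  shows "0 \<le> (1 + dunkl_sigma z x y) * dunkl_kappa \<alpha> x y z"
    "(1 + dunkl_sigma z x y) * dunkl_kappa \<alpha> x y z \<le> 2 * dunkl_kappa \<alpha> x y z"
proof -
  have "dunkl_kappa \<alpha> x y z = 0 \<or> (0 \<le> 1 + dunkl_sigma z x y \<and> 1 + dunkl_sigma z x y \<le> 2)"
    using dunkl_sigma_le_1_support(2)[of \<alpha> x y z] by (auto simp: abs_le_iff)
  then show "0 \<le> (1 + dunkl_sigma z x y) * dunkl_kappa \<alpha> x y z"
    "(1 + dunkl_sigma z x y) * dunkl_kappa \<alpha> x y z \<le> 2 * dunkl_kappa \<alpha> x y z"
    using dunkl_kappa_nonneg[OF assms] by (auto intro: mult_right_mono)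
qed

section \<open>Homogeneity of the kernel\<close>

lemma dunkl_sigma_scale: "t \<noteq> 0 \<Longrightarrow> dunkl_sigma (t * x) (t * y) (t * z) = dunkl_sigma x y z"
proof -
  assume t: "t \<noteq> 0"
  have "(t * x)\<^sup>2 + (t * y)\<^sup>2 - (t * z)\<^sup>2 = t\<^sup>2 * (x\<^sup>2 + y\<^sup>2 - z\<^sup>2)" "2 * (t * x) * (t * y) = t\<^sup>2 * (2 * x * y)"
    by (simp_all add: power2_eq_square algebra_simps)
  then show ?thesis
    unfolding dunkl_sigma_def using t by (simp only: mult_divide_mult_cancel_left_if) simp
qed

text \<open>The numerator has degree 4(\<alpha> - 1/2) and the denominator 6\<alpha>; the difference
  is -2\<alpha> - 2. The triangle condition is invariant under scaling.\<close>

lemma dunkl_kappa_scale: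
  assumes t: "t \<noteq> 0"
  shows "dunkl_kappa \<alpha> (t * x) (t * y) (t * z) = \<bar>t\<bar> powr (- dunkl_dim \<alpha>) * dunkl_kappa \<alpha> x y z"
proof -
  define T where "T = \<bar>t\<bar>"
  have T: "T > 0" using t by (simp add: T_def)
  have supp: "\<bar>t * z\<bar> \<in> {\<bar>\<bar>t * x\<bar> - \<bar>t * y\<bar>\<bar>..\<bar>t * x\<bar> + \<bar>t * y\<bar>} \<longleftrightarrow> \<bar>z\<bar> \<in> {\<bar>\<bar>x\<bar> - \<bar>y\<bar>\<bar>..\<bar>x\<bar> + \<bar>y\<bar>}"
  proof -
    have "\<bar>\<bar>t * x\<bar> - \<bar>t * y\<bar>\<bar> = T * \<bar>\<bar>x\<bar> - \<bar>y\<bar>\<bar>" "\<bar>t * x\<bar> + \<bar>t * y\<bar> = T * (\<bar>x\<bar> + \<bar>y\<bar>)" "\<bar>t * z\<bar> = T * \<bar>z\<bar>"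
      by (simp_all add: T_def abs_mult right_diff_distrib[symmetric] distrib_left)
    then show ?thesis using T by (simp del: abs_mult)
  qed
  show ?thesis
  proof (cases "\<bar>z\<bar> \<in> {\<bar>\<bar>x\<bar> - \<bar>y\<bar>\<bar>..\<bar>x\<bar> + \<bar>y\<bar>}")
    case True
    define P where "P = ((\<bar>x\<bar> + \<bar>y\<bar>)\<^sup>2 - z\<^sup>2) * (z\<^sup>2 - (\<bar>x\<bar> - \<bar>y\<bar>)\<^sup>2)"
    have P: "P \<ge> 0"
      unfolding P_def using True
      by (intro mult_nonneg_nonneg) (simp_all add: abs_le_square_iff[symmetric])
    have "((\<bar>t * x\<bar> + \<bar>t * y\<bar>)\<^sup>2 - (t * z)\<^sup>2) * ((t * z)\<^sup>2 - (\<bar>t * x\<bar> - \<bar>t * y\<bar>)\<^sup>2) = T ^ 4 * P"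
    proof -
      have *: "((T * a)\<^sup>2 - T\<^sup>2 * c) * (T\<^sup>2 * c - (T * b)\<^sup>2) = T ^ 4 * ((a\<^sup>2 - c) * (c - b\<^sup>2))" for a b c :: real
        by algebra
      have "\<bar>t * x\<bar> + \<bar>t * y\<bar> = T * (\<bar>x\<bar> + \<bar>y\<bar>)" "\<bar>t * x\<bar> - \<bar>t * y\<bar> = T * (\<bar>x\<bar> - \<bar>y\<bar>)" "(t * z)\<^sup>2 = T\<^sup>2 * z\<^sup>2"
        by (simp_all add: T_def abs_mult right_diff_distrib distrib_left power_mult_distrib)
      then show ?thesis unfolding P_def *[symmetric] by (simp only:)
    qed
    moreover have "(T ^ 4 * P) powr (\<alpha> - 1 / 2) = T powr (4 * \<alpha> - 2) * P powr (\<alpha> - 1 / 2)"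
    proof -
      have "(T ^ 4) powr (\<alpha> - 1 / 2) = T powr (4 * \<alpha> - 2)"
      proof -
        have "T ^ 4 = T powr 4" using T by simp
        then show ?thesis by (simp only: powr_powr) (simp add: right_diff_distrib)
      qed
      then show ?thesis using T P by (simp add: powr_mult)
    qed
    moreover have "\<bar>t * x * (t * y) * (t * z)\<bar> powr (2 * \<alpha>) = T powr (6 * \<alpha>) * \<bar>x * y * z\<bar> powr (2 * \<alpha>)"
    proof -
      have "\<bar>t * x * (t * y) * (t * z)\<bar> = T ^ 3 * \<bar>x * y * z\<bar>"
        by (simp add: T_def abs_mult power3_eq_cube)
      moreover have "(T ^ 3) powr (2 * \<alpha>) = T powr (6 * \<alpha>)"
      proof -
        have "T ^ 3 = T powr 3" using T by simp
        then show ?thesis by (simp only: powr_powr) simp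
      qed
      ultimately show ?thesis using T by (simp add: powr_mult)
    qed
    moreover have "T powr (4 * \<alpha> - 2) = T powr (- dunkl_dim \<alpha>) * T powr (6 * \<alpha>)"
      using T by (simp add: powr_add[symmetric] dunkl_dim_def)
    ultimately show ?thesis
      using True T unfolding dunkl_kappa_def supp P_def[symmetric] T_def[symmetric]
      by simp
  next
    case False
    then show ?thesis unfolding dunkl_kappa_def supp by (simp only: if_False mult_zero_right)
  qed
qed

section \<open>The uniform integral bound for kappa\<close>

text \<open>Both parameters of the Beta integral equal \<alpha> + 1/2, and the assumption says that
  they are positive.\<close>

lemma nn_integral_symmetric_Beta:
  assumes "\<alpha> > - 1 / 2"
  shows "(\<integral>\<^sup>+s. ennreal ((s * (1 - s)) powr (\<alpha> - 1 / 2) * indicator {0..1} s) \<partial>lborel) < \<infinity>"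
proof -
  have "((\<lambda>s. s powr (\<alpha> + 1 / 2 - 1) * (1 - s) powr (\<alpha> + 1 / 2 - 1)) has_integral Beta (\<alpha> + 1 / 2) (\<alpha> + 1 / 2)) {0..1}"
    using assms by (intro has_integral_Beta_real) auto
  from nn_integral_has_integral_lebesgue[OF _ this]
  have "(\<integral>\<^sup>+s. ennreal (indicator {0..1} s * (s powr (\<alpha> - 1 / 2) * (1 - s) powr (\<alpha> - 1 / 2))) \<partial>lborel) < \<infinity>"
    by (simp add: nn_integral_completion)
  moreover have "ennreal ((s * (1 - s)) powr (\<alpha> - 1 / 2) * indicator {0..1} s) =
      ennreal (indicator {0..1} s * (s powr (\<alpha> - 1 / 2) * (1 - s) powr (\<alpha> - 1 / 2)))" for s :: real
    by (simp add: powr_mult indicator_def)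
  ultimately show ?thesis by (simp only:)
qed

text \<open>With \<open>u = y\<^sup>2\<close> the integral becomes a multiple of
  \<open>\<integral> ((b - u) * (u - a)) powr (\<alpha> - 1 / 2) du\<close> over \<open>{a..b}\<close>, where
  \<open>b - a = 4 * \<bar>x * z\<bar>\<close>; the powers of \<open>\<bar>x * z\<bar>\<close> cancel and a Beta integral remains.\<close>

lemma dunkl_kappa_integral_bound:
  assumes \<alpha>: "\<alpha> > - 1 / 2"
  obtains C where "0 \<le> C"
    "\<And>x z. x \<noteq> 0 \<Longrightarrow> (\<integral>\<^sup>+y. ennreal (dunkl_kappa \<alpha> x y z) \<partial>dunkl_borel \<alpha>) \<le> ennreal C"
proof -
  define \<beta> where "\<beta> = \<alpha> - 1 / 2"
  define f :: "real \<Rightarrow> real" where "f s = (s * (1 - s)) powr \<beta>" for s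
  obtain B where B: "(\<integral>\<^sup>+s. ennreal (f s * indicator {0..1} s) \<partial>lborel) = ennreal B" "0 \<le> B"
    using nn_integral_symmetric_Beta[OF \<alpha>] unfolding f_def \<beta>_def
    by (cases "\<integral>\<^sup>+s. ennreal ((s * (1 - s)) powr (\<alpha> - 1 / 2) * indicator {0..1} s) \<partial>lborel") auto
  have A: "dunkl_A \<alpha> > 0" using \<alpha> by (intro dunkl_A_pos) auto
  have D: "dunkl_D \<alpha> \<ge> 0" using \<alpha> by (rule dunkl_D_nonneg)
  \<comment> \<open>The factor \<open>16 powr \<beta>\<close> comes from
    \<open>(4 * X * Z)\<^sup>2\<close> raised to \<beta>, and the 2 from
    \<open>y / (X * Z) = 2 * G' y\<close>, where \<open>X\<close>, \<open>Z\<close> and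
    \<open>G'\<close> are introduced below.\<close>
  define C where "C = dunkl_A \<alpha> * dunkl_D \<alpha> * 16 powr \<beta> * 2"
  have C: "C \<ge> 0" using A D by (simp add: C_def)
  have "(\<integral>\<^sup>+y. ennreal (dunkl_kappa \<alpha> x y z) \<partial>dunkl_borel \<alpha>) \<le> ennreal (2 * C * B)" if x: "x \<noteq> 0" for x z
  proof (cases "z = 0")
    case True
    \<comment> \<open>The denominator is \<open>0 powr (2 * \<alpha>) = 0\<close>, and division by
      it gives 0.\<close>
    then have "dunkl_kappa \<alpha> x y z = 0" for y by (auto simp: dunkl_kappa_def)
    then show ?thesis by simp
  next
    case False
    define X where "X = \<bar>x\<bar>"
    define Z where "Z = \<bar>z\<bar>"
    have XZ: "X > 0" "Z > 0" using x False by (auto simp: X_def Z_def)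
    define l where "l = \<bar>X - Z\<bar>"
    define u where "u = X + Z"
    have lu: "0 \<le> l" "l \<le> u" using XZ by (auto simp: l_def u_def)
    \<comment> \<open>\<open>G\<close> is the square of \<open>y\<close> followed by the affine map
      of [l^2, u^2] onto [0, 1], with u^2 - l^2 = 4XZ; \<open>G'\<close> is its derivative.\<close>
    define G where "G y = (y\<^sup>2 - (X - Z)\<^sup>2) / (4 * X * Z)" for y
    define G' where "G' y = y / (2 * X * Z)" for y
    define h where "h y = dunkl_A \<alpha> * \<bar>y\<bar> powr (2 * \<alpha> + 1) * dunkl_kappa \<alpha> x y z" for y
    have h: "h y = C * (f (G y) * G' y)" if y: "y \<in> {l..u}" "y > 0" for y
    proof -
      have supp: "\<bar>z\<bar> \<in> {\<bar>\<bar>x\<bar> - \<bar>y\<bar>\<bar>..\<bar>x\<bar> + \<bar>y\<bar>}"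
        using y by (auto simp: X_def Z_def l_def u_def)
      have G1: "1 - G y = ((X + Z)\<^sup>2 - y\<^sup>2) / (4 * X * Z)"
        using XZ by (simp add: G_def field_simps power2_eq_square)
      have pos: "0 \<le> G y" "0 \<le> 1 - G y"
        unfolding G1 unfolding G_def using XZ y
        by (auto simp: l_def u_def abs_le_square_iff[symmetric] intro!: divide_nonneg_nonneg)
      have GG: "G y * (1 - G y) * (4 * X * Z)\<^sup>2 = (y\<^sup>2 - (X - Z)\<^sup>2) * ((X + Z)\<^sup>2 - y\<^sup>2)"
        unfolding G1 unfolding G_def using XZ by (simp add: power2_eq_square)
      \<comment> \<open>By Heron's formula the product is 16 times a squared triangle area. It is
        therefore symmetric in the sides and can be regrouped around \<open>y\<close>.\<close>
      have "((\<bar>x\<bar> + \<bar>y\<bar>)\<^sup>2 - z\<^sup>2) * (z\<^sup>2 - (\<bar>x\<bar> - \<bar>y\<bar>)\<^sup>2) = (y\<^sup>2 - (X - Z)\<^sup>2) * ((X + Z)\<^sup>2 - y\<^sup>2)"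
      proof -
        have "z\<^sup>2 = Z\<^sup>2" "\<bar>y\<bar> = y" using y by (simp_all add: Z_def)
        moreover have "((X + y)\<^sup>2 - Z\<^sup>2) * (Z\<^sup>2 - (X - y)\<^sup>2) = (y\<^sup>2 - (X - Z)\<^sup>2) * ((X + Z)\<^sup>2 - y\<^sup>2)"
          by algebra
        ultimately show ?thesis unfolding X_def[symmetric] by (simp only:)
      qed
      also have "\<dots> powr \<beta> = (G y * (1 - G y)) powr \<beta> * ((4 * X * Z)\<^sup>2) powr \<beta>"
        using pos by (simp add: GG[symmetric] powr_mult)
      also have "((4 * X * Z)\<^sup>2) powr \<beta> = 16 powr \<beta> * (X * Z) powr (2 * \<alpha> - 1)"
      proof -
        have "(4 * X * Z)\<^sup>2 = 16 * (X * Z) powr 2"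
          using XZ by (simp add: power_mult_distrib)
        also have "\<dots> powr \<beta> = 16 powr \<beta> * (X * Z) powr (2 * \<beta>)"
          by (simp only: powr_mult[of 16] powr_powr)
        also have "2 * \<beta> = 2 * \<alpha> - 1" by (simp add: \<beta>_def)
        finally show ?thesis .
      qed
      finally have powb: "(((\<bar>x\<bar> + \<bar>y\<bar>)\<^sup>2 - z\<^sup>2) * (z\<^sup>2 - (\<bar>x\<bar> - \<bar>y\<bar>)\<^sup>2)) powr (\<alpha> - 1 / 2)
          = f (G y) * (16 powr \<beta> * (X * Z) powr (2 * \<alpha> - 1))"
        by (simp add: f_def \<beta>_def)
      have den: "\<bar>x * y * z\<bar> powr (2 * \<alpha>) = (X * Z) powr (2 * \<alpha>) * y powr (2 * \<alpha>)"
        using y by (simp add: X_def Z_def abs_mult powr_mult)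
      have "h y = dunkl_A \<alpha> * y powr (2 * \<alpha> + 1) * (dunkl_D \<alpha> *
          (f (G y) * (16 powr \<beta> * (X * Z) powr (2 * \<alpha> - 1))) / ((X * Z) powr (2 * \<alpha>) * y powr (2 * \<alpha>)))"
        using supp y by (simp only: h_def dunkl_kappa_def if_True powb den)
      also have "\<dots> = dunkl_A \<alpha> * dunkl_D \<alpha> * 16 powr \<beta> * f (G y) *
          (y powr (2 * \<alpha> + 1) / y powr (2 * \<alpha>)) * ((X * Z) powr (2 * \<alpha> - 1) / (X * Z) powr (2 * \<alpha>))"
        by (simp add: mult_ac)
      also have "y powr (2 * \<alpha> + 1) / y powr (2 * \<alpha>) = y"
        using y by (simp add: powr_diff[symmetric])
      also have "(X * Z) powr (2 * \<alpha> - 1) / (X * Z) powr (2 * \<alpha>) = 1 / (X * Z)"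
        using XZ by (simp add: powr_diff[symmetric] powr_minus_divide)
      finally show ?thesis
        using XZ by (simp add: C_def G'_def)
    qed
    have "(\<integral>\<^sup>+y. ennreal (dunkl_kappa \<alpha> x y z) \<partial>dunkl_borel \<alpha>) = (\<integral>\<^sup>+y. ennreal (h y) \<partial>lborel)"
      using A by (simp add: nn_integral_dunkl_borel h_def ennreal_mult'[symmetric])
    \<comment> \<open>As a function of \<open>y\<close> the even function \<open>h\<close> lives on
      [l, u] and its mirror image; each half contributes \<open>C * B\<close>.\<close>
    also have "\<dots> \<le> (\<integral>\<^sup>+y. ennreal (h y * indicator {l..u} y) + ennreal (h (- y) * indicator {l..u} (- y)) \<partial>lborel)"
    proof (intro nn_integral_mono)
      fix y
      show "ennreal (h y) \<le> ennreal (h y * indicator {l..u} y) + ennreal (h (- y) * indicator {l..u} (- y))"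
      proof (cases "h y = 0")
        case False
        then have "dunkl_kappa \<alpha> x y z \<noteq> 0" by (auto simp: h_def)
        from dunkl_kappa_support[OF this] have "y \<in> {l..u} \<or> - y \<in> {l..u}"
          unfolding l_def u_def X_def Z_def atLeastAtMost_iff by linarith
        moreover have "h (- y) = h y" by (simp add: h_def)
        ultimately show ?thesis by (auto simp: indicator_def)
      qed simp
    qed
    also have "\<dots> = (\<integral>\<^sup>+y. ennreal (h y * indicator {l..u} y) \<partial>lborel)
        + (\<integral>\<^sup>+y. ennreal (h (- y) * indicator {l..u} (- y)) \<partial>lborel)"
      unfolding h_def by (intro nn_integral_add) measurable
    also have "(\<integral>\<^sup>+y. ennreal (h (- y) * indicator {l..u} (- y)) \<partial>lborel)
        = (\<integral>\<^sup>+y. ennreal (h y * indicator {l..u} y) \<partial>lborel)"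
    proof -
      have [measurable]: "(\<lambda>y. ennreal (h y * indicator {l..u} y)) \<in> borel_measurable borel"
        unfolding h_def by measurable
      show ?thesis
        by (subst (2) nn_integral_real_affine[where c="-1" and t=0]) auto
    qed
    also have "(\<integral>\<^sup>+y. ennreal (h y * indicator {l..u} y) \<partial>lborel) \<le> ennreal (C * B)"
    proof -
      have "(\<integral>\<^sup>+y. ennreal (h y * indicator {l..u} y) \<partial>lborel)
          = (\<integral>\<^sup>+y. ennreal C * ennreal (f (G y) * G' y * indicator {l..u} y) \<partial>lborel)"
      proof (intro nn_integral_cong_AE)
        show "AE y in lborel. ennreal (h y * indicator {l..u} y) = ennreal C * ennreal (f (G y) * G' y * indicator {l..u} y)"
          using AE_lborel_singleton[of 0]
        proof eventually_elim
          case (elim y)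
          then show ?case
            using h[of y] lu C by (cases "y \<in> {l..u}") (auto simp: ennreal_mult'[symmetric])
        qed
      qed
      also have "\<dots> = ennreal C * (\<integral>\<^sup>+y. ennreal (f (G y) * G' y * indicator {l..u} y) \<partial>lborel)"
        unfolding f_def G_def G'_def by (intro nn_integral_cmult) measurable
      also have "(\<integral>\<^sup>+y. ennreal (f (G y) * G' y * indicator {l..u} y) \<partial>lborel)
          = (\<integral>\<^sup>+s. ennreal (f s * indicator {G l..G u} s) \<partial>lborel)"
      proof (rule nn_integral_substitution[symmetric])
        show "set_borel_measurable borel {G l..G u} f"
          unfolding set_borel_measurable_def f_def by measurable
        show "(G has_real_derivative G' y) (at y)" for y
          unfolding G_def G'_def using XZ by (auto intro!: derivative_eq_intros simp: field_simps)
        show "continuous_on {l..u} G'"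
          unfolding G'_def using XZ by (auto intro!: continuous_intros)
        show "G' y \<ge> 0" if "y \<in> {l..u}" for y
          using that lu XZ by (auto simp: G'_def)
      qed (use lu in auto)
      also have "G l = 0"
        by (simp add: G_def l_def)
      also have "G u = 1"
        using XZ by (simp add: G_def u_def field_simps power2_eq_square)
      also have "ennreal C * (\<integral>\<^sup>+s. ennreal (f s * indicator {0..1} s) \<partial>lborel) = ennreal (C * B)"
        using B C by (simp add: ennreal_mult)
      finally show ?thesis by simp
    qed
    finally show ?thesis
      using C B by (simp add: ennreal_plus[symmetric] add_mono mult_ac del: ennreal_plus)
  qed
  moreover have "0 \<le> 2 * C * B" using C B by simp
  ultimately show ?thesis using that by blast
qed

section \<open>Ball averages of translates\<close>

text \<open>The density of \<open>g \<mapsto> \<integral>\<^bsub>B(0,r)\<^esub> \<tau>\<^sub>x g d\<mu>\<close>. Averaging \<open>dunkl_W\<close> over \<open>y\<close> and \<open>- y\<close> removes the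
  two terms \<open>dunkl_sigma x y z\<close> and \<open>dunkl_sigma z y x\<close>, which are odd in \<open>y\<close>, and what remains is nonnegative.\<close>

definition dunkl_ball_kernel :: "real \<Rightarrow> real \<Rightarrow> real \<Rightarrow> real \<Rightarrow> ennreal" where
  "dunkl_ball_kernel \<alpha> x r z =
     (if \<alpha> = - 1 / 2 \<or> x = 0 then indicator (ball x r) z
      else \<integral>\<^sup>+y. ennreal (indicator (ball 0 r) y * ((1 + dunkl_sigma z x y) * dunkl_kappa \<alpha> x y z)) \<partial>dunkl_borel \<alpha>)"

lemma ball_borel_measurable [measurable]: "ball (a::'a::metric_space) r \<in> sets borel"
  by simp

lemma dunkl_ball_kernel_measurable [measurable]: "dunkl_ball_kernel \<alpha> x r \<in> borel_measurable borel"
proof -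
  interpret sigma_finite_measure "dunkl_borel \<alpha>" by (rule sigma_finite_dunkl_borel)
  have "(\<lambda>z. \<integral>\<^sup>+y. ennreal (indicator (ball 0 r) y * ((1 + dunkl_sigma z x y) * dunkl_kappa \<alpha> x y z)) \<partial>dunkl_borel \<alpha>)
      \<in> borel_measurable borel"
    by measurable
  then show ?thesis
    unfolding dunkl_ball_kernel_def[abs_def] by (cases "\<alpha> = - 1 / 2 \<or> x = 0") simp_all
qed

lemma ball_real_scale:
  fixes t x r z :: real
  assumes "t \<noteq> 0"
  shows "t * z \<in> ball x r \<longleftrightarrow> z \<in> ball (x / t) (r / \<bar>t\<bar>)"
proof -
  have "\<bar>x - t * z\<bar> = \<bar>t\<bar> * \<bar>x / t - z\<bar>"
    using assms by (simp add: abs_mult[symmetric] right_diff_distrib)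
  then show ?thesis using assms by (simp add: dist_real_def pos_less_divide_eq mult.commute)
qed

text \<open>In the generic case the factor |t|^d of the measure cancels the degree -d of
  \<open>dunkl_kappa\<close>, and \<open>dunkl_sigma\<close> has degree 0.\<close>

lemma dunkl_ball_kernel_scale:
  assumes t: "t \<noteq> 0" and \<alpha>: "\<alpha> \<ge> - 1 / 2"
  shows "dunkl_ball_kernel \<alpha> x r (t * z) = dunkl_ball_kernel \<alpha> (x / t) (r / \<bar>t\<bar>) z"
proof (cases "\<alpha> = - 1 / 2 \<or> x = 0")
  case True
  then show ?thesis
    using ball_real_scale[OF t, of z x r] by (auto simp: dunkl_ball_kernel_def indicator_def simp del: mem_ball)
next
  case False
  then have x: "x \<noteq> 0" and \<alpha>': "\<alpha> > - 1 / 2" using \<alpha> by auto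
  let ?w = "\<lambda>x y z. (1 + dunkl_sigma z x y) * dunkl_kappa \<alpha> x y z"
  have w: "?w x (t * y) (t * z) = \<bar>t\<bar> powr (- dunkl_dim \<alpha>) * ?w (x / t) y z" for y
    using dunkl_sigma_scale[OF t, of z "x / t" y] dunkl_kappa_scale[OF t, of \<alpha> "x / t" y z] t by simp
  have "dunkl_ball_kernel \<alpha> x r (t * z) = (\<integral>\<^sup>+y. ennreal (indicator (ball 0 r) y * ?w x y (t * z)) \<partial>dunkl_borel \<alpha>)"
    using False by (simp add: dunkl_ball_kernel_def)
  also have "\<dots> = ennreal (\<bar>t\<bar> powr dunkl_dim \<alpha>) *
      (\<integral>\<^sup>+y. ennreal (indicator (ball 0 r) (t * y) * ?w x (t * y) (t * z)) \<partial>dunkl_borel \<alpha>)"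
    using \<alpha>' t by (intro nn_integral_dunkl_borel_scale) auto
  also have "(\<integral>\<^sup>+y. ennreal (indicator (ball 0 r) (t * y) * ?w x (t * y) (t * z)) \<partial>dunkl_borel \<alpha>)
      = (\<integral>\<^sup>+y. ennreal (\<bar>t\<bar> powr (- dunkl_dim \<alpha>)) * ennreal (indicator (ball 0 (r / \<bar>t\<bar>)) y * ?w (x / t) y z) \<partial>dunkl_borel \<alpha>)"
  proof (intro nn_integral_cong)
    fix y
    have "indicator (ball 0 r) (t * y) = (indicator (ball 0 (r / \<bar>t\<bar>)) y :: real)"
      using ball_real_scale[OF t, of y 0 r] by (simp add: indicator_def del: mem_ball)
    then show "ennreal (indicator (ball 0 r) (t * y) * ?w x (t * y) (t * z))
      = ennreal (\<bar>t\<bar> powr (- dunkl_dim \<alpha>)) * ennreal (indicator (ball 0 (r / \<bar>t\<bar>)) y * ?w (x / t) y z)"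
      unfolding w by (simp add: ennreal_mult'[symmetric] mult_ac)
  qed
  also have "\<dots> = ennreal (\<bar>t\<bar> powr (- dunkl_dim \<alpha>)) * dunkl_ball_kernel \<alpha> (x / t) (r / \<bar>t\<bar>) z"
    using False t unfolding dunkl_ball_kernel_def by (subst nn_integral_cmult) auto
  also have "ennreal (\<bar>t\<bar> powr dunkl_dim \<alpha>) * \<dots> = dunkl_ball_kernel \<alpha> (x / t) (r / \<bar>t\<bar>) z"
    using t by (simp add: mult.assoc[symmetric] ennreal_mult'[symmetric] powr_minus)
  finally show ?thesis .
qed

text \<open>Pointwise finiteness makes the measure with this density sigma-finite, as Minkowski's
  inequality requires.\<close>

lemma dunkl_ball_kernel_finite:
  assumes "\<alpha> \<ge> - 1 / 2"
  shows "dunkl_ball_kernel \<alpha> x r z < \<infinity>"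
proof (cases "\<alpha> = - 1 / 2 \<or> x = 0")
  case False
  then have \<alpha>: "\<alpha> > - 1 / 2" and x: "x \<noteq> 0" using assms by auto
  obtain C where C: "\<And>z. (\<integral>\<^sup>+y. ennreal (dunkl_kappa \<alpha> x y z) \<partial>dunkl_borel \<alpha>) \<le> ennreal C"
    using dunkl_kappa_integral_bound[OF \<alpha>] x by metis
  have "dunkl_ball_kernel \<alpha> x r z \<le> (\<integral>\<^sup>+y. ennreal 2 * ennreal (dunkl_kappa \<alpha> x y z) \<partial>dunkl_borel \<alpha>)"
    unfolding dunkl_ball_kernel_def if_not_P[OF False]
  proof (intro nn_integral_mono)
    fix y
    have "indicator (ball 0 r) y * ((1 + dunkl_sigma z x y) * dunkl_kappa \<alpha> x y z) \<le> 2 * dunkl_kappa \<alpha> x y z"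
      using dunkl_kappa_weight_nonneg[OF \<alpha>] dunkl_kappa_nonneg[OF \<alpha>] by (simp add: indicator_def)
    then show "ennreal (indicator (ball 0 r) y * ((1 + dunkl_sigma z x y) * dunkl_kappa \<alpha> x y z))
        \<le> ennreal 2 * ennreal (dunkl_kappa \<alpha> x y z)"
      by (subst ennreal_mult'[symmetric]) (auto intro: ennreal_leI)
  qed
  also have "\<dots> = ennreal 2 * (\<integral>\<^sup>+y. ennreal (dunkl_kappa \<alpha> x y z) \<partial>dunkl_borel \<alpha>)"
    by (intro nn_integral_cmult) measurable
  also have "\<dots> < \<infinity>"
    using le_less_trans[OF C[of z] ennreal_less_top] by (simp add: ennreal_mult_less_top)
  finally show ?thesis .
qed (simp add: dunkl_ball_kernel_def indicator_def)

section \<open>Ball averages as weighted integrals\<close>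

text \<open>The Borel counterpart of local integrability for nonnegative \<open>g\<close>; centred
  balls suffice because every compact set lies in one.\<close>

definition dunkl_locally_finite :: "real \<Rightarrow> (real \<Rightarrow> real) \<Rightarrow> bool" where
  "dunkl_locally_finite \<alpha> g \<longleftrightarrow> (\<forall>R. (\<integral>\<^sup>+z. ennreal (indicator (ball 0 R) z * g z) \<partial>dunkl_borel \<alpha>) < \<infinity>)"

text \<open>Absolute integrability of \<open>F\<close> follows from |W| \<le> 4 kappa, the uniform
  bound on the integral of kappa in \<open>y\<close>, and local finiteness of \<open>g\<close> on
  the ball of radius r + |x|. Fubini then moves the integral in \<open>y\<close> inside, where
  symmetrization identifies it with the kernel.\<close>

lemma integral_ball_dunkl_translation_generic:
  assumes \<alpha>: "\<alpha> > - 1 / 2" and x: "x \<noteq> 0"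
    and g[measurable]: "g \<in> borel_measurable borel" and nn: "\<And>z. 0 \<le> g z"
    and fin: "dunkl_locally_finite \<alpha> g"
  shows "(\<integral>\<^sup>+z. ennreal (g z) * dunkl_ball_kernel \<alpha> x r z \<partial>dunkl_borel \<alpha>) =
      ennreal (LINT y|dunkl_borel \<alpha>. indicator (ball 0 r) y * (LINT z|dunkl_borel \<alpha>. g z * dunkl_W \<alpha> x y z))"
    and "0 \<le> (LINT y|dunkl_borel \<alpha>. indicator (ball 0 r) y * (LINT z|dunkl_borel \<alpha>. g z * dunkl_W \<alpha> x y z))"
proof -
  let ?m = "dunkl_borel \<alpha>"
  let ?w = "\<lambda>y z. indicator (ball 0 r) y * ((1 + dunkl_sigma z x y) * dunkl_kappa \<alpha> x y z)"
  interpret sigma_finite_measure ?m by (rule sigma_finite_dunkl_borel)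
  interpret P: pair_sigma_finite ?m ?m ..
  obtain C where C: "0 \<le> C" "\<And>z. (\<integral>\<^sup>+y. ennreal (dunkl_kappa \<alpha> x y z) \<partial>?m) \<le> ennreal C"
    using dunkl_kappa_integral_bound[OF \<alpha>] x by metis
  define F where "F y z = indicator (ball 0 r) y * (g z * dunkl_W \<alpha> x y z)" for y z
  have [measurable]: "case_prod F \<in> borel_measurable (?m \<Otimes>\<^sub>M ?m)"
    unfolding F_def by measurable
  have "(\<integral>\<^sup>+y. \<integral>\<^sup>+z. ennreal (norm (F y z)) \<partial>?m \<partial>?m) = (\<integral>\<^sup>+z. \<integral>\<^sup>+y. ennreal (norm (F y z)) \<partial>?m \<partial>?m)"
    by (intro P.Fubini'[symmetric]) measurable
  also have "\<dots> \<le> (\<integral>\<^sup>+z. ennreal (4 * C) * ennreal (indicator (ball 0 (r + \<bar>x\<bar>)) z * g z) \<partial>?m)"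
  proof (intro nn_integral_mono)
    fix z
    let ?c = "indicator (ball 0 (r + \<bar>x\<bar>)) z * g z"
    have "ennreal (norm (F y z)) \<le> ennreal (4 * ?c) * ennreal (dunkl_kappa \<alpha> x y z)" for y
    proof (cases "dunkl_kappa \<alpha> x y z = 0 \<or> y \<notin> ball 0 r")
      case True
      then show ?thesis using dunkl_W_abs_le[OF \<alpha>, of x y z] by (auto simp: F_def)
    next
      case False
      then have "z \<in> ball 0 (r + \<bar>x\<bar>)"
        using dunkl_kappa_support[of \<alpha> x y z] by (auto simp: dist_real_def)
      then show ?thesis
        using False nn dunkl_W_abs_le[OF \<alpha>, of x y z]
        by (auto simp: F_def abs_mult ennreal_mult'[symmetric] simp del: mem_ball
            intro!: ennreal_leI order_trans[OF mult_left_mono[of "\<bar>dunkl_W \<alpha> x y z\<bar>" "4 * dunkl_kappa \<alpha> x y z" "g z"]])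
    qed
    then have "(\<integral>\<^sup>+y. ennreal (norm (F y z)) \<partial>?m) \<le> (\<integral>\<^sup>+y. ennreal (4 * ?c) * ennreal (dunkl_kappa \<alpha> x y z) \<partial>?m)"
      by (intro nn_integral_mono)
    also have "\<dots> = ennreal (4 * ?c) * (\<integral>\<^sup>+y. ennreal (dunkl_kappa \<alpha> x y z) \<partial>?m)"
      by (intro nn_integral_cmult) measurable
    also have "\<dots> \<le> ennreal (4 * ?c) * ennreal C"
      using C by (intro mult_left_mono) auto
    also have "\<dots> = ennreal (4 * C) * ennreal ?c"
      using C nn by (simp add: ennreal_mult'[symmetric] ennreal_mult''[symmetric] mult_ac)
    finally show "(\<integral>\<^sup>+y. ennreal (norm (F y z)) \<partial>?m) \<le> ennreal (4 * C) * ennreal ?c" .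
  qed
  also have "\<dots> = ennreal (4 * C) * (\<integral>\<^sup>+z. ennreal (indicator (ball 0 (r + \<bar>x\<bar>)) z * g z) \<partial>?m)"
    by (intro nn_integral_cmult) measurable
  also have "\<dots> < \<infinity>"
    using fin by (simp add: dunkl_locally_finite_def ennreal_mult_less_top)
  finally have bound: "(\<integral>\<^sup>+y. \<integral>\<^sup>+z. ennreal (norm (F y z)) \<partial>?m \<partial>?m) < \<infinity>" .
  have intF: "integrable (?m \<Otimes>\<^sub>M ?m) (case_prod F)"
    using bound by (simp add: integrable_iff_bounded nn_integral_fst[symmetric] case_prod_beta')
  have inner: "(LINT y|?m. F y z) = g z * enn2real (dunkl_ball_kernel \<alpha> x r z)" "dunkl_ball_kernel \<alpha> x r z < \<infinity>" for z
  proof -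
    let ?H = "\<lambda>y. indicator (ball 0 r) y * dunkl_W \<alpha> x y z"
    have kint: "integrable ?m (\<lambda>y. 4 * dunkl_kappa \<alpha> x y z)"
      using C(2)[of z] dunkl_kappa_nonneg[OF \<alpha>]
      by (intro integrable_mult_right integrableI_bounded) (auto intro: le_less_trans)
    have Hint: "integrable ?m ?H"
      by (rule Bochner_Integration.integrable_bound[OF kint])
        (use dunkl_W_abs_le[OF \<alpha>] dunkl_kappa_nonneg[OF \<alpha>] in \<open>auto simp: abs_mult indicator_def\<close>)
    have reflect: "(LINT y|?m. ?H y) = (LINT y|?m. ?H (- y))" "integrable ?m (\<lambda>y. ?H (- y))"
    proof -
      have "(LINT y|distr ?m borel uminus. ?H y) = (LINT y|?m. ?H (- y))"
        by (intro integral_distr) measurable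
      then show "(LINT y|?m. ?H y) = (LINT y|?m. ?H (- y))"
        by (simp add: dunkl_borel_reflect)
      have "integrable (distr ?m borel uminus) ?H \<longleftrightarrow> integrable ?m (\<lambda>y. ?H (- y))"
        by (intro integrable_distr_eq) measurable
      then show "integrable ?m (\<lambda>y. ?H (- y))"
        using Hint by (simp add: dunkl_borel_reflect)
    qed
    \<comment> \<open>Adding the reflected integral leaves the value doubled and brings in
      \<open>dunkl_W_symmetrized\<close>.\<close>
    have "2 * (LINT y|?m. ?H y) = (LINT y|?m. ?H y + ?H (- y))"
      using Hint reflect by simp
    also have "\<dots> = (LINT y|?m. 2 * ?w y z)"
    proof (intro Bochner_Integration.integral_cong refl)
      fix y :: real
      have "indicator (ball 0 r) (- y) = (indicator (ball 0 r) y :: real)"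
        by (simp add: indicator_def dist_norm)
      then show "?H y + ?H (- y) = 2 * ?w y z"
        using dunkl_W_symmetrized[of \<alpha> x y z] by (simp add: distrib_left[symmetric])
    qed
    also have "\<dots> = 2 * (LINT y|?m. ?w y z)" by simp
    also have "(LINT y|?m. ?w y z) = enn2real (dunkl_ball_kernel \<alpha> x r z)"
      using x \<alpha> dunkl_kappa_weight_nonneg[OF \<alpha>] unfolding dunkl_ball_kernel_def
      by (subst integral_eq_nn_integral) auto
    finally show "(LINT y|?m. F y z) = g z * enn2real (dunkl_ball_kernel \<alpha> x r z)"
      by (simp add: F_def mult.left_commute)
    show "dunkl_ball_kernel \<alpha> x r z < \<infinity>"
      using \<alpha> by (intro dunkl_ball_kernel_finite) auto
  qed
  have "integrable ?m (\<lambda>z. LINT y|?m. F y z)"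
    using P.integrable_snd[OF intF] .
  then have int: "integrable ?m (\<lambda>z. g z * enn2real (dunkl_ball_kernel \<alpha> x r z))"
    by (simp add: inner)
  have eq: "(LINT y|?m. indicator (ball 0 r) y * (LINT z|?m. g z * dunkl_W \<alpha> x y z)) = (LINT z|?m. g z * enn2real (dunkl_ball_kernel \<alpha> x r z))"
    using P.Fubini_integral[OF intF] by (simp add: F_def[symmetric] inner(1)[symmetric]) (simp add: F_def)
  show "0 \<le> (LINT y|?m. indicator (ball 0 r) y * (LINT z|?m. g z * dunkl_W \<alpha> x y z))"
    unfolding eq using nn by (intro integral_nonneg_AE) auto
  show "(\<integral>\<^sup>+z. ennreal (g z) * dunkl_ball_kernel \<alpha> x r z \<partial>?m) =
      ennreal (LINT y|?m. indicator (ball 0 r) y * (LINT z|?m. g z * dunkl_W \<alpha> x y z))"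
    unfolding eq using nn inner(2) 
    by (subst nn_integral_eq_integral[OF int, symmetric])
      (auto simp: ennreal_mult' intro!: nn_integral_cong)
qed

lemma AE_lborel_translate:
  assumes "AE y in lborel. P y"
  shows "AE y in lborel. P (x + (y::real))"
proof -
  obtain N where N: "{y. \<not> P y} \<subseteq> N" "N \<in> null_sets lborel"
    using assms by (auto simp: eventually_ae_filter)
  have "AE y in lborel. x + 1 * y \<notin> N"
    using N by (intro AE_borel_affine AE_not_in) auto
  then show ?thesis by eventually_elim (use N in auto)
qed

text \<open>Since \<open>0 powr 0 = 0\<close>, the weight is constant only off the origin, hence the
  passage through a null set.\<close>

lemma nn_integral_dunkl_borel_neg_half:
  assumes [measurable]: "f \<in> borel_measurable borel"
  shows "(\<integral>\<^sup>+y. f y \<partial>dunkl_borel (- 1 / 2)) = ennreal (dunkl_A (- 1 / 2)) * (\<integral>\<^sup>+y. f y \<partial>lborel)"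
proof -
  have "(\<integral>\<^sup>+y. f y \<partial>dunkl_borel (- 1 / 2)) = (\<integral>\<^sup>+y. ennreal (dunkl_A (- 1 / 2)) * f y \<partial>lborel)"
    unfolding nn_integral_dunkl_borel[OF assms]
    by (rule nn_integral_cong_AE, use AE_lborel_singleton[of "0::real"] in eventually_elim) simp
  then show ?thesis by (simp add: nn_integral_cmult)
qed

lemma ennreal_integral_eq_nn_integral:
  assumes "f \<in> borel_measurable M" "\<And>x. 0 \<le> f x" "(\<integral>\<^sup>+x. ennreal (f x) \<partial>M) < \<infinity>"
  shows "ennreal (integral\<^sup>L M f) = (\<integral>\<^sup>+x. ennreal (f x) \<partial>M)"
  using assms by (subst integral_eq_nn_integral) auto

text \<open>The function \<open>h\<close> is a mere almost-everywhere copy of \<open>g\<close>. In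
  each branch of the translation the change is invisible after integration: null sets survive
  shifts, and the integral against \<open>dunkl_W\<close> ignores them.\<close>

lemma integral_ball_dunkl_translation:
  assumes \<alpha>: "\<alpha> \<ge> - 1 / 2"
    and g[measurable]: "g \<in> borel_measurable borel" and nn: "\<And>z. 0 \<le> g z"
    and fin: "dunkl_locally_finite \<alpha> g"
    and h: "AE z in lborel. h z = g z"
  shows "ennreal (LINT y:ball 0 r|dunkl_measure \<alpha>. dunkl_translation \<alpha> x h y)
      = (\<integral>\<^sup>+z. ennreal (g z) * dunkl_ball_kernel \<alpha> x r z \<partial>dunkl_borel \<alpha>)" (is ?eq)
    and "0 \<le> (LINT y:ball 0 r|dunkl_measure \<alpha>. dunkl_translation \<alpha> x h y)" (is ?nonneg)
proof -
  let ?m = "dunkl_borel \<alpha>"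
  have \<alpha>1: "\<alpha> > - 1" using \<alpha> by simp
  have transfer: "(LINT y:ball 0 r|dunkl_measure \<alpha>. dunkl_translation \<alpha> x h y) = (LINT y|?m. indicator (ball 0 r) y * k y)"
    if k: "k \<in> borel_measurable borel" and ae: "AE y in lborel. dunkl_translation \<alpha> x h y = k y" for k
    unfolding set_lebesgue_integral_def dunkl_measure_eq_completion[OF \<alpha>1]
  proof (rule integral_completion_AE)
    show "(\<lambda>y. indicator (ball 0 r) y * k y) \<in> borel_measurable ?m"
      using k by measurable
    show "AE y in ?m. indicator (ball 0 r) y *\<^sub>R dunkl_translation \<alpha> x h y = indicator (ball 0 r) y * k y"
      unfolding AE_dunkl_borel_iff[OF \<alpha>1] using ae by eventually_elim simp
  qed
  have loc: "(\<integral>\<^sup>+z. ennreal (indicator (ball 0 R) z * g z) \<partial>?m) < \<infinity>" for R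
    using fin by (simp add: dunkl_locally_finite_def)
  consider (half) "\<alpha> = - 1 / 2" | (zero) "\<alpha> > - 1 / 2" "x = 0" | (generic) "\<alpha> > - 1 / 2" "x \<noteq> 0"
    using \<alpha> by linarith
  then have "?eq \<and> ?nonneg"
  proof cases
    case half
    have "(LINT y:ball 0 r|dunkl_measure \<alpha>. dunkl_translation \<alpha> x h y) = (LINT y|?m. indicator (ball 0 r) y * g (x + y))"
      using AE_lborel_translate[OF h, of x] half by (intro transfer) (auto simp: dunkl_translation_def)
    moreover have shift: "(\<integral>\<^sup>+y. ennreal (indicator (ball 0 r) y * g (x + y)) \<partial>?m) = (\<integral>\<^sup>+z. ennreal (indicator (ball x r) z * g z) \<partial>?m)"
    proof -
      have "(\<integral>\<^sup>+z. ennreal (indicator (ball x r) z * g z) \<partial>lborel)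
          = (\<integral>\<^sup>+y. ennreal (indicator (ball x r) (x + y) * g (x + y)) \<partial>lborel)"
        by (subst nn_integral_real_affine[where c=1 and t=x]) auto
      also have "(\<lambda>y. indicator (ball x r) (x + y)) = (indicator (ball 0 r) :: real \<Rightarrow> real)"
        by (auto simp: indicator_def dist_real_def fun_eq_iff)
      then have "(\<integral>\<^sup>+y. ennreal (indicator (ball x r) (x + y) * g (x + y)) \<partial>lborel)
          = (\<integral>\<^sup>+y. ennreal (indicator (ball 0 r) y * g (x + y)) \<partial>lborel)"
        by (simp add: fun_eq_iff)
      finally show ?thesis
        by (simp add: nn_integral_dunkl_borel_neg_half[folded half])
    qed
    moreover have "(\<integral>\<^sup>+z. ennreal (indicator (ball x r) z * g z) \<partial>?m) < \<infinity>"
    proof -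
      have "indicator (ball x r) z * g z \<le> indicator (ball 0 (\<bar>x\<bar> + r)) z * g z" for z
        using nn[of z] by (auto simp: indicator_def dist_real_def)
      then have "(\<integral>\<^sup>+z. ennreal (indicator (ball x r) z * g z) \<partial>?m)
          \<le> (\<integral>\<^sup>+z. ennreal (indicator (ball 0 (\<bar>x\<bar> + r)) z * g z) \<partial>?m)"
        by (intro nn_integral_mono ennreal_leI)
      also note loc
      finally show ?thesis .
    qed
    moreover have "ennreal (g z) * dunkl_ball_kernel \<alpha> x r z = ennreal (indicator (ball x r) z * g z)" for z
      using half by (simp add: dunkl_ball_kernel_def indicator_def)
    ultimately show ?thesis
      using nn by (auto simp: ennreal_integral_eq_nn_integral intro!: integral_nonneg_AE)
  next
    case zero
    have "(LINT y:ball 0 r|dunkl_measure \<alpha>. dunkl_translation \<alpha> x h y) = (LINT y|?m. indicator (ball 0 r) y * g y)"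
    proof (rule transfer[OF g])
      show "AE y in lborel. dunkl_translation \<alpha> x h y = g y"
        using h AE_lborel_singleton[of 0] by eventually_elim (use zero in \<open>simp add: dunkl_translation_def\<close>)
    qed
    moreover have "ennreal (g z) * dunkl_ball_kernel \<alpha> x r z = ennreal (indicator (ball 0 r) z * g z)" for z
      using zero by (simp add: dunkl_ball_kernel_def indicator_def)
    ultimately show ?thesis
      using nn loc[of r] by (auto simp: ennreal_integral_eq_nn_integral intro!: integral_nonneg_AE)
  next
    case generic
    have "(LINT y:ball 0 r|dunkl_measure \<alpha>. dunkl_translation \<alpha> x h y)
        = (LINT y|?m. indicator (ball 0 r) y * (LINT z|?m. g z * dunkl_W \<alpha> x y z))"
    proof (rule transfer)
      interpret sigma_finite_measure ?m by (rule sigma_finite_dunkl_borel)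
      show "(\<lambda>y. LINT z|?m. g z * dunkl_W \<alpha> x y z) \<in> borel_measurable borel"
        by measurable
      have W: "(LINT z|dunkl_measure \<alpha>. h z * dunkl_W \<alpha> x y z) = (LINT z|?m. g z * dunkl_W \<alpha> x y z)" for y
        unfolding dunkl_measure_eq_completion[OF \<alpha>1]
      proof (rule integral_completion_AE)
        show "AE z in ?m. h z * dunkl_W \<alpha> x y z = g z * dunkl_W \<alpha> x y z"
          unfolding AE_dunkl_borel_iff[OF \<alpha>1] using h by eventually_elim simp
      qed measurable
      \<comment> \<open>At \<open>y = 0\<close> the translation is a point evaluation, so that point
        is discarded.\<close>
      show "AE y in lborel. dunkl_translation \<alpha> x h y = (LINT z|?m. g z * dunkl_W \<alpha> x y z)"
        using AE_lborel_singleton[of 0] by eventually_elim (use generic in \<open>simp add: dunkl_translation_def W\<close>)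
    qed
    then show ?thesis
      using integral_ball_dunkl_translation_generic[OF generic g nn fin] by simp
  qed
  then show ?eq ?nonneg by simp_all
qed

section \<open>Morrey norm and local integrability through Borel representatives\<close>

text \<open>The ball averages are nonnegative and finite, so the power 1/p can be undone. Bounds on
  the norm become bounds linear in the weighted integral, the form to which Minkowski's inequality
  applies.\<close>

lemma dunkl_morrey_norm_le_iff:
  assumes \<alpha>: "\<alpha> \<ge> - 1 / 2" and p: "1 \<le> p" and \<phi>: "\<And>r. r > 0 \<Longrightarrow> \<phi> r > 0"
    and g[measurable]: "g \<in> borel_measurable borel" and f: "AE z in lborel. f z = g z"
    and fin: "dunkl_locally_finite \<alpha> (\<lambda>z. norm (g z) powr p)" and M: "0 \<le> M"
  shows "dunkl_morrey_norm \<alpha> p \<phi> f \<le> ennreal M \<longleftrightarrow>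
    (\<forall>x. \<forall>r>0. (\<integral>\<^sup>+z. ennreal (norm (g z) powr p) * dunkl_ball_kernel \<alpha> x r z \<partial>dunkl_borel \<alpha>)
        \<le> ennreal ((M * \<phi> r) powr p * r powr dunkl_dim \<alpha>))"
proof -
  define J where "J x r = (LINT y:ball 0 r|dunkl_measure \<alpha>. dunkl_translation \<alpha> x (\<lambda>z. norm (f z) powr p) y)" for x r
  have "AE z in lborel. norm (f z) powr p = norm (g z) powr p"
    using f by eventually_elim simp
  from integral_ball_dunkl_translation[OF \<alpha> _ _ fin this]
  have J: "ennreal (J x r) = (\<integral>\<^sup>+z. ennreal (norm (g z) powr p) * dunkl_ball_kernel \<alpha> x r z \<partial>dunkl_borel \<alpha>)"
    "0 \<le> J x r" for x r
    by (simp_all add: J_def)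
  have "1 / \<phi> r * (1 / r powr dunkl_dim \<alpha> * J x r) powr (1 / p) \<le> M \<longleftrightarrow>
      J x r \<le> (M * \<phi> r) powr p * r powr dunkl_dim \<alpha>" if r: "r > 0" for x r
  proof -
    let ?j = "1 / r powr dunkl_dim \<alpha> * J x r"
    have j: "0 \<le> ?j" using J(2) by simp
    have "1 / \<phi> r * ?j powr (1 / p) \<le> M \<longleftrightarrow> ?j powr (1 / p) \<le> M * \<phi> r"
      using \<phi>[OF r] by (simp add: pos_divide_le_eq)
    also have "\<dots> \<longleftrightarrow> (?j powr (1 / p)) powr p \<le> (M * \<phi> r) powr p"
      using p M \<phi>[OF r] powr_less_mono2[of p "M * \<phi> r" "?j powr (1 / p)"]
      by (auto intro!: powr_mono2 simp: not_le[symmetric])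
    also have "(?j powr (1 / p)) powr p = ?j"
      using p j J(2)[of x r] by (simp add: powr_powr)
    also have "?j \<le> (M * \<phi> r) powr p \<longleftrightarrow> J x r \<le> (M * \<phi> r) powr p * r powr dunkl_dim \<alpha>"
      using r by (simp add: pos_divide_le_eq)
    finally show ?thesis .
  qed
  then show ?thesis
    unfolding dunkl_morrey_norm_def J_def[symmetric]
    by (auto simp: SUP_le_iff J(1)[symmetric] M ennreal_le_iff)
qed

lemma dunkl_locally_integrable_imp_locally_finite:
  assumes \<alpha>: "\<alpha> \<ge> - 1 / 2" and f: "dunkl_locally_integrable \<alpha> p f"
    and g[measurable]: "g \<in> borel_measurable borel" and ae: "AE z in lborel. f z = g z"
  shows "dunkl_locally_finite \<alpha> (\<lambda>z. norm (g z) powr p)"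
  unfolding dunkl_locally_finite_def
proof
  fix R :: real
  have \<alpha>1: "\<alpha> > - 1" using \<alpha> by simp
  have "set_integrable (dunkl_measure \<alpha>) (cball 0 R) (\<lambda>x. norm (f x) powr p)"
    using f by (simp add: dunkl_locally_integrable_def)
  then have "(\<integral>\<^sup>+z. ennreal (indicator (cball 0 R) z * norm (f z) powr p) \<partial>dunkl_borel \<alpha>) < \<infinity>"
    unfolding set_integrable_def integrable_iff_bounded dunkl_measure_eq_completion[OF \<alpha>1]
    by (simp add: nn_integral_completion abs_mult)
  moreover have "(\<integral>\<^sup>+z. ennreal (indicator (ball 0 R) z * norm (g z) powr p) \<partial>dunkl_borel \<alpha>)
      \<le> (\<integral>\<^sup>+z. ennreal (indicator (cball 0 R) z * norm (f z) powr p) \<partial>dunkl_borel \<alpha>)"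
  proof (rule nn_integral_mono_AE)
    show "AE z in dunkl_borel \<alpha>. ennreal (indicator (ball 0 R) z * norm (g z) powr p)
        \<le> ennreal (indicator (cball 0 R) z * norm (f z) powr p)"
      unfolding AE_dunkl_borel_iff[OF \<alpha>1] using ae
      by eventually_elim (auto simp: indicator_def)
  qed
  ultimately show "(\<integral>\<^sup>+z. ennreal (indicator (ball 0 R) z * norm (g z) powr p) \<partial>dunkl_borel \<alpha>) < \<infinity>"
    by (rule le_less_trans[rotated])
qed

lemma dunkl_locally_finite_imp_locally_integrable:
  assumes \<alpha>: "\<alpha> \<ge> - 1 / 2"
    and g[measurable]: "g \<in> borel_measurable borel" and ae: "AE z in lborel. f z = g z"
    and fin: "dunkl_locally_finite \<alpha> (\<lambda>z. norm (g z) powr p)"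
  shows "dunkl_locally_integrable \<alpha> p f"
  unfolding dunkl_locally_integrable_def
proof (intro conjI allI impI)
  have \<alpha>1: "\<alpha> > - 1" using \<alpha> by simp
  show "f \<in> borel_measurable lebesgue"
    using ae by (intro measurable_completion_AE[of g]) auto
  fix K :: "real set" assume K: "compact K"
  then obtain R where R: "K \<subseteq> ball 0 R"
    using bounded_subset_ballD compact_imp_bounded by blast
  have [measurable]: "K \<in> sets borel" using K by (simp add: borel_closed compact_imp_closed)
  have ae': "AE z in dunkl_borel \<alpha>. indicator K z *\<^sub>R norm (f z) powr p = indicator K z * norm (g z) powr p"
    unfolding AE_dunkl_borel_iff[OF \<alpha>1] using ae by eventually_elim simp
  show "set_integrable (dunkl_measure \<alpha>) K (\<lambda>x. norm (f x) powr p)"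
    unfolding set_integrable_def integrable_iff_bounded dunkl_measure_eq_completion[OF \<alpha>1]
  proof
    show "(\<lambda>x. indicator K x *\<^sub>R norm (f x) powr p) \<in> borel_measurable (completion (dunkl_borel \<alpha>))"
      by (rule measurable_completion_AE[OF _ ae']) measurable
    have "(\<integral>\<^sup>+x. ennreal (norm (indicator K x *\<^sub>R norm (f x) powr p)) \<partial>dunkl_borel \<alpha>)
        \<le> (\<integral>\<^sup>+x. ennreal (indicator (ball 0 R) x * norm (g x) powr p) \<partial>dunkl_borel \<alpha>)"
      by (rule nn_integral_mono_AE, use ae' in eventually_elim) (use R in \<open>auto simp: indicator_def\<close>)
    also have "\<dots> < \<infinity>" using fin by (simp add: dunkl_locally_finite_def)
    finally show "(\<integral>\<^sup>+x. ennreal (norm (indicator K x *\<^sub>R norm (f x) powr p)) \<partial>completion (dunkl_borel \<alpha>)) < \<infinity>"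
      by (simp add: nn_integral_completion)
  qed
qed

section \<open>The Hausdorff operator\<close>

text \<open>With \<open>\<bar>\<psi> t\<bar> / \<bar>t\<bar> powr dunkl_dim \<alpha> * M * \<phi> (r / \<bar>t\<bar>) * r powr (dunkl_dim \<alpha> / p)\<close> as majorant:
  the substitution \<open>z \<mapsto> t * z\<close> carries the ball integral of \<open>\<lambda>z. g (z / t)\<close> with parameters \<open>(x, r)\<close>
  to that of \<open>g\<close> with parameters \<open>(x / t, r / \<bar>t\<bar>)\<close>.\<close>

lemma hausdorff_ball_estimate:
  fixes g \<psi> :: "real \<Rightarrow> complex" and \<phi> \<phi>' :: "real \<Rightarrow> real"
  assumes \<alpha>: "\<alpha> \<ge> - 1 / 2" and p: "1 \<le> p" and \<phi>: "\<And>r. r > 0 \<Longrightarrow> \<phi> r > 0"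
    and [measurable]: "\<phi>' \<in> borel_measurable borel" "\<psi> \<in> borel_measurable borel" "g \<in> borel_measurable borel"
    and \<phi>': "AE r in lborel. r > 0 \<longrightarrow> \<phi> r = \<phi>' r"
    and M: "0 < M" and K: "0 < K" and r: "0 < r"
    and bound: "\<And>x r. r > 0 \<Longrightarrow> (\<integral>\<^sup>+z. ennreal (norm (g z) powr p) * dunkl_ball_kernel \<alpha> x r z \<partial>dunkl_borel \<alpha>)
        \<le> ennreal ((M * \<phi> r) powr p * r powr dunkl_dim \<alpha>)"
    and K_bound: "(\<integral>\<^sup>+t. ennreal (norm (\<psi> t) / \<bar>t\<bar> powr dunkl_dim \<alpha> * \<phi> (r / \<bar>t\<bar>)) \<partial>lborel) \<le> ennreal (K * \<phi> r)"
  shows "(\<integral>\<^sup>+z. ennreal_powr p (\<integral>\<^sup>+t. ennreal (norm (\<psi> t) / \<bar>t\<bar> powr dunkl_dim \<alpha> * norm (g (z / t))) \<partial>lborel)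
            * dunkl_ball_kernel \<alpha> x r z \<partial>dunkl_borel \<alpha>)
      \<le> ennreal ((M * K * \<phi> r) powr p * r powr dunkl_dim \<alpha>)"
proof -
  let ?m = "dunkl_borel \<alpha>"
  let ?d = "dunkl_dim \<alpha>"
  have \<alpha>1: "\<alpha> > - 1" using \<alpha> by simp
  define a where "a t = norm (\<psi> t) / \<bar>t\<bar> powr ?d" for t
  \<comment> \<open>\<open>\<phi>'\<close> may fail to be positive on a null set or on the negative
    half-line. The value 1 there makes \<open>c\<close> nonnegative and lets it vanish only where
    \<open>a\<close> does.\<close>
  define \<phi>'' where "\<phi>'' s = (if \<phi>' s > 0 then \<phi>' s else 1)" for s
  define c where "c t = a t * \<phi>'' (r / \<bar>t\<bar>) * (M * r powr (?d / p))" for t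
  define F where "F z t = a t * norm (g (z / t))" for z t
  define N where "N = density ?m (dunkl_ball_kernel \<alpha> x r)"
  have [measurable]: "a \<in> borel_measurable borel" "\<phi>'' \<in> borel_measurable borel"
    unfolding a_def \<phi>''_def by measurable
  have a: "0 \<le> a t" for t by (simp add: a_def)
  have \<phi>''_pos: "0 < \<phi>'' s" for s by (simp add: \<phi>''_def)
  have R: "0 < M * r powr (?d / p)" using M r by simp
  have Rp: "(r powr (?d / p)) powr p = r powr ?d" using p by (simp add: powr_powr)
  \<comment> \<open>The argument r/|t| is r/t or -r/t according to the sign of \<open>t\<close>, so
    the null-set lemma is applied to both.\<close>
  have \<phi>_eq: "AE t in lborel. t \<noteq> 0 \<and> \<phi>'' (r / \<bar>t\<bar>) = \<phi> (r / \<bar>t\<bar>)"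
  proof -
    have "AE t in lborel. r / t > 0 \<longrightarrow> \<phi> (r / t) = \<phi>' (r / t)"
      using r by (intro AE_lborel_divide[OF \<phi>']) auto
    moreover have "AE t in lborel. - r / t > 0 \<longrightarrow> \<phi> (- r / t) = \<phi>' (- r / t)"
      using r by (intro AE_lborel_divide[OF \<phi>']) auto
    ultimately show ?thesis
      using AE_lborel_singleton[of 0]
    proof eventually_elim
      case (elim t)
      have "r / \<bar>t\<bar> > 0" using r elim by simp
      moreover have "r / \<bar>t\<bar> = r / t \<or> r / \<bar>t\<bar> = - r / t" by (cases "t > 0") auto
      ultimately have "\<phi> (r / \<bar>t\<bar>) = \<phi>' (r / \<bar>t\<bar>)" using elim by auto
      with \<phi>[OF \<open>r / \<bar>t\<bar> > 0\<close>] show ?case using elim by (simp add: \<phi>''_def)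
    qed
  qed
  have "(\<integral>\<^sup>+z. ennreal_powr p (\<integral>\<^sup>+t. ennreal (F z t) \<partial>lborel) \<partial>N) \<le> ennreal ((K * \<phi> r * (M * r powr (?d / p))) powr p)"
  proof (rule Minkowski_integral_majorant[where c=c])
    show "sigma_finite_measure N"
      unfolding N_def using dunkl_ball_kernel_finite[OF \<alpha>]
      by (subst sigma_finite_measure.sigma_finite_iff_density_finite[OF sigma_finite_dunkl_borel])
        (auto simp: less_top[symmetric])
    show "sigma_finite_measure lborel" by (rule sigma_finite_lborel)
    have "case_prod F \<in> borel_measurable (borel \<Otimes>\<^sub>M borel)"
      unfolding F_def by measurable
    moreover have "sets (N \<Otimes>\<^sub>M lborel) = sets (borel \<Otimes>\<^sub>M borel)"
      by (intro sets_pair_measure_cong) (simp_all add: N_def)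
    ultimately show "case_prod F \<in> borel_measurable (N \<Otimes>\<^sub>M lborel)"
      using measurable_cong_sets by blast
    show "c \<in> borel_measurable lborel" unfolding c_def by measurable
    show "0 \<le> F z t" for z t using a by (simp add: F_def)
    show "0 \<le> c t" for t using a[of t] \<phi>''_pos[of "r / \<bar>t\<bar>"] R by (simp add: c_def)
    show "F z t = 0" if "c t = 0" for z t
      using that \<phi>''_pos[of "r / \<bar>t\<bar>"] M r by (simp add: c_def F_def)
    show "0 < K * \<phi> r * (M * r powr (?d / p))" using K \<phi>[OF r] R by simp
    show "AE t in lborel. (\<integral>\<^sup>+z. ennreal (F z t powr p) \<partial>N) \<le> ennreal (c t powr p)"
      using \<phi>_eq
    proof eventually_elim
      case (elim t)
      then have t: "t \<noteq> 0" by simp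
      have rt: "r / \<bar>t\<bar> > 0" using r t by simp
      let ?G = "\<lambda>z. ennreal (norm (g (z / t)) powr p) * dunkl_ball_kernel \<alpha> x r z"
      have "(\<integral>\<^sup>+z. ennreal (F z t powr p) \<partial>N) = (\<integral>\<^sup>+z. ennreal (a t powr p) * ?G z \<partial>?m)"
        unfolding N_def F_def using a
        by (subst nn_integral_density) (auto simp: powr_mult ennreal_mult' mult_ac)
      also have "\<dots> = ennreal (a t powr p) * (\<integral>\<^sup>+z. ?G z \<partial>?m)"
        by (intro nn_integral_cmult) measurable
      also have "(\<integral>\<^sup>+z. ?G z \<partial>?m) = ennreal (\<bar>t\<bar> powr ?d) * (\<integral>\<^sup>+z. ?G (t * z) \<partial>?m)"
        by (intro nn_integral_dunkl_borel_scale t \<alpha>1) measurable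
      also have "(\<integral>\<^sup>+z. ?G (t * z) \<partial>?m)
          = (\<integral>\<^sup>+z. ennreal (norm (g z) powr p) * dunkl_ball_kernel \<alpha> (x / t) (r / \<bar>t\<bar>) z \<partial>?m)"
        using t by (simp add: dunkl_ball_kernel_scale[OF t \<alpha>])
      also have "\<dots> \<le> ennreal ((M * \<phi> (r / \<bar>t\<bar>)) powr p * (r / \<bar>t\<bar>) powr ?d)"
        by (rule bound[OF rt])
      also have "ennreal (a t powr p) * (ennreal (\<bar>t\<bar> powr ?d) * ennreal ((M * \<phi> (r / \<bar>t\<bar>)) powr p * (r / \<bar>t\<bar>) powr ?d))
          = ennreal (c t powr p)"
      proof -
        \<comment> \<open>The cancellation that leaves no power of \<open>t\<close> in the majorant
          beyond the one inside \<open>a\<close>.\<close>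
        have "\<bar>t\<bar> powr ?d * (r / \<bar>t\<bar>) powr ?d = r powr ?d"
          using t r by (simp add: powr_divide)
        then have "a t powr p * (\<bar>t\<bar> powr ?d * ((M * \<phi> (r / \<bar>t\<bar>)) powr p * (r / \<bar>t\<bar>) powr ?d))
            = a t powr p * (M * \<phi> (r / \<bar>t\<bar>)) powr p * r powr ?d"
          by (simp add: mult_ac)
        also have "\<dots> = c t powr p"
          using a[of t] \<phi>[OF rt] M r elim by (simp add: c_def powr_mult Rp mult_ac)
        finally show ?thesis by (simp add: ennreal_mult'[symmetric])
      qed
      finally show ?case by (simp add: mult_left_mono)
    qed
    have "(\<integral>\<^sup>+t. ennreal (c t) \<partial>lborel)
        = (\<integral>\<^sup>+t. ennreal (M * r powr (?d / p)) * ennreal (a t * \<phi>'' (r / \<bar>t\<bar>)) \<partial>lborel)"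
      using R by (intro nn_integral_cong) (simp add: c_def ennreal_mult'[symmetric] mult_ac)
    also have "\<dots> = ennreal (M * r powr (?d / p)) * (\<integral>\<^sup>+t. ennreal (a t * \<phi>'' (r / \<bar>t\<bar>)) \<partial>lborel)"
      by (intro nn_integral_cmult) measurable
    also have "(\<integral>\<^sup>+t. ennreal (a t * \<phi>'' (r / \<bar>t\<bar>)) \<partial>lborel) = (\<integral>\<^sup>+t. ennreal (a t * \<phi> (r / \<bar>t\<bar>)) \<partial>lborel)"
      by (rule nn_integral_cong_AE, use \<phi>_eq in eventually_elim) simp
    also have "\<dots> \<le> ennreal (K * \<phi> r)" using K_bound by (simp add: a_def)
    also have "ennreal (M * r powr (?d / p)) * ennreal (K * \<phi> r) = ennreal (K * \<phi> r * (M * r powr (?d / p)))"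
      using R by (subst ennreal_mult'[symmetric]) (simp_all add: mult_ac)
    finally show "(\<integral>\<^sup>+t. ennreal (c t) \<partial>lborel) \<le> ennreal (K * \<phi> r * (M * r powr (?d / p)))"
      by (simp add: mult_left_mono)
  qed (use p in auto)
  also have "(K * \<phi> r * (M * r powr (?d / p))) powr p = (M * K * \<phi> r) powr p * r powr ?d"
    using K M \<phi>[OF r] r by (simp add: powr_mult Rp mult_ac)
  also have "(\<integral>\<^sup>+z. ennreal_powr p (\<integral>\<^sup>+t. ennreal (F z t) \<partial>lborel) \<partial>N)
      = (\<integral>\<^sup>+z. ennreal_powr p (\<integral>\<^sup>+t. ennreal (F z t) \<partial>lborel) * dunkl_ball_kernel \<alpha> x r z \<partial>?m)"
    unfolding N_def F_def by (subst nn_integral_density) (auto simp: mult.commute)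
  finally show ?thesis by (simp add: F_def a_def)
qed

section \<open>Borel representatives for the operator and the final estimate\<close>

lemma borel_measurable_Ioi_ex_borel:
  fixes \<phi> :: "real \<Rightarrow> real"
  assumes "\<phi> \<in> borel_measurable (lebesgue_on {0<..})"
  obtains \<phi>' where "\<phi>' \<in> borel_measurable borel" "AE r in lborel. r > 0 \<longrightarrow> \<phi> r = \<phi>' r"
proof -
  have "(\<lambda>r. if r \<in> {0<..} then \<phi> r else 0) \<in> borel_measurable lebesgue"
    using assms by (subst borel_measurable_if) auto
  then obtain \<phi>' where \<phi>': "\<phi>' \<in> borel_measurable lborel" "AE r in lborel. (if r \<in> {0<..} then \<phi> r else 0) = \<phi>' r"
    using completion_ex_borel_measurable_real by blast
  show ?thesis
  proof
    show "\<phi>' \<in> borel_measurable borel" using \<phi>'(1) by simp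
    show "AE r in lborel. r > 0 \<longrightarrow> \<phi> r = \<phi>' r" using \<phi>'(2) by eventually_elim (auto split: if_splits)
  qed
qed

text \<open>The point \<open>x = 0\<close> is excluded because there the integrand sees only the
  single value of \<open>f\<close> at 0, which a change on a null set may alter.\<close>

lemma dunkl_hausdorff_eq_borel:
  assumes [measurable]: "f' \<in> borel_measurable borel" "\<psi>' \<in> borel_measurable borel"
    and f: "AE z in lborel. f z = f' z" and \<psi>: "AE t in lborel. \<psi> t = \<psi>' t" and x: "x \<noteq> 0"
  shows "AE t in lborel. hausdorff_integrand \<alpha> \<psi> f x t = hausdorff_integrand \<alpha> \<psi>' f' x t"
    and "dunkl_hausdorff \<alpha> \<psi> f x = (LINT t|lborel. hausdorff_integrand \<alpha> \<psi>' f' x t)"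
proof -
  show ae: "AE t in lborel. hausdorff_integrand \<alpha> \<psi> f x t = hausdorff_integrand \<alpha> \<psi>' f' x t"
    using \<psi> AE_lborel_divide[OF f x] by eventually_elim (simp add: hausdorff_integrand_def)
  have "(\<lambda>t. hausdorff_integrand \<alpha> \<psi>' f' x t) \<in> borel_measurable lborel"
    unfolding hausdorff_integrand_def by measurable
  from integral_completion_AE[OF this ae]
  show "dunkl_hausdorff \<alpha> \<psi> f x = (LINT t|lborel. hausdorff_integrand \<alpha> \<psi>' f' x t)"
    by (simp add: dunkl_hausdorff_def)
qed

lemma norm_hausdorff_integrand:
  "norm (hausdorff_integrand \<alpha> \<psi> f x t) = norm (\<psi> t) / \<bar>t\<bar> powr dunkl_dim \<alpha> * norm (f (x / t))"
  by (simp add: hausdorff_integrand_def dunkl_dim_def norm_mult norm_divide)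

text \<open>Without integrability the Bochner integral is 0, and with an infinite right-hand side
  nothing is claimed, so no assumption on \<open>f\<close> is needed.\<close>

lemma norm_integral_powr_le_ennreal_powr:
  fixes f :: "'a \<Rightarrow> complex"
  assumes p: "0 \<le> p"
  shows "ennreal (norm (integral\<^sup>L M f) powr p) \<le> ennreal_powr p (\<integral>\<^sup>+t. ennreal (norm (f t)) \<partial>M)"
proof (cases "(\<integral>\<^sup>+t. ennreal (norm (f t)) \<partial>M) = \<infinity>")
  case False
  have "ennreal (norm (integral\<^sup>L M f)) \<le> (\<integral>\<^sup>+t. ennreal (norm (f t)) \<partial>M)"
    by (cases "integrable M f") (auto simp: integral_norm_bound_ennreal not_integrable_integral_eq)
  then have "norm (integral\<^sup>L M f) \<le> enn2real (\<integral>\<^sup>+t. ennreal (norm (f t)) \<partial>M)"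
    using False by (metis enn2real_ennreal enn2real_mono infinity_ennreal_def less_top norm_ge_zero)
  then show ?thesis
    using p False by (simp add: ennreal_powr_def ennreal_leI powr_mono2)
qed (simp add: ennreal_powr_def)

text \<open>Minkowski's inequality is stated with a strictly positive constant, while K or the norm
  of f may be 0. Both are enlarged by 1/(n+1), and the limit recovers the sharp product.\<close>

lemma ennreal_le_mult_of_approx:
  fixes a b c :: ennreal
  assumes b: "b < \<infinity>" and c: "c < \<infinity>"
    and le: "\<And>u v. 0 < u \<Longrightarrow> 0 < v \<Longrightarrow> b \<le> ennreal u \<Longrightarrow> c \<le> ennreal v \<Longrightarrow> a \<le> ennreal (u * v)"
  shows "a \<le> b * c"
proof -
  obtain b' c' where bc: "b = ennreal b'" "0 \<le> b'" "c = ennreal c'" "0 \<le> c'"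
    using b c by (cases b; cases c) auto
  have "(\<lambda>n. (b' + inverse (real (Suc n))) * (c' + inverse (real (Suc n)))) \<longlonglongrightarrow> (b' + 0) * (c' + 0)"
    by (intro tendsto_intros LIMSEQ_inverse_real_of_nat)
  then have "(\<lambda>n. ennreal ((b' + inverse (real (Suc n))) * (c' + inverse (real (Suc n))))) \<longlonglongrightarrow> ennreal (b' * c')"
    by (intro tendsto_ennrealI) simp
  moreover have "a \<le> ennreal ((b' + inverse (real (Suc n))) * (c' + inverse (real (Suc n))))" for n
    using bc by (intro le) (auto intro!: ennreal_leI add_nonneg_pos)
  ultimately have "a \<le> ennreal (b' * c')"
    by (intro LIMSEQ_le_const) auto
  then show ?thesis using bc by (simp add: ennreal_mult)
qed

theorem theorem3p1:
  fixes \<alpha> p :: real and \<phi> :: "real \<Rightarrow> real" and \<psi> :: "real \<Rightarrow> complex"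
  assumes "\<alpha> \<ge> - 1 / 2" and "1 \<le> p"
    and "\<And>r. r > 0 \<Longrightarrow> \<phi> r > 0"
    and "\<phi> \<in> borel_measurable (lebesgue_on {0<..})"
    and "almost_decreasing \<phi>"
    and "almost_increasing (\<lambda>r. r powr (dunkl_dim \<alpha> / p) * \<phi> r)"
    and "\<psi> \<in> borel_measurable lebesgue"
    and "hausdorff_K \<alpha> \<phi> \<psi> < \<infinity>"
  shows "\<forall>f \<in> dunkl_morrey \<alpha> p \<phi>.
           (AE x in dunkl_measure \<alpha>. integrable lebesgue (hausdorff_integrand \<alpha> \<psi> f x)) \<and>
           dunkl_hausdorff \<alpha> \<psi> f \<in> dunkl_morrey \<alpha> p \<phi> \<and>
           dunkl_morrey_norm \<alpha> p \<phi> (dunkl_hausdorff \<alpha> \<psi> f)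
             \<le> hausdorff_K \<alpha> \<phi> \<psi> * dunkl_morrey_norm \<alpha> p \<phi> f"
proof
  fix f assume f: "f \<in> dunkl_morrey \<alpha> p \<phi>"
  note \<alpha> = assms(1) and p = assms(2) and \<phi> = assms(3)
  have \<alpha>1: "\<alpha> > - 1" using \<alpha> by simp
  let ?m = "dunkl_borel \<alpha>"
  have locf: "dunkl_locally_integrable \<alpha> p f" and normf: "dunkl_morrey_norm \<alpha> p \<phi> f < \<infinity>"
    using f by (auto simp: dunkl_morrey_def)
  obtain f' where f'[measurable]: "f' \<in> borel_measurable borel" and ff': "AE z in lborel. f z = f' z"
    using locf lebesgue_ex_borel unfolding dunkl_locally_integrable_def by metis
  obtain \<psi>' where [measurable]: "\<psi>' \<in> borel_measurable borel" and \<psi>\<psi>': "AE t in lborel. \<psi> t = \<psi>' t"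
    using assms(7) lebesgue_ex_borel by metis
  obtain \<phi>' where [measurable]: "\<phi>' \<in> borel_measurable borel" and \<phi>\<phi>': "AE r in lborel. r > 0 \<longrightarrow> \<phi> r = \<phi>' r"
    using assms(4) by (rule borel_measurable_Ioi_ex_borel)
  have finf: "dunkl_locally_finite \<alpha> (\<lambda>z. norm (f' z) powr p)"
    by (rule dunkl_locally_integrable_imp_locally_finite[OF \<alpha> locf f' ff'])
  \<comment> \<open>The operator with absolute values inside, allowed to be infinite. It dominates
    \<open>h'\<close>, and its finiteness at almost every point is the existence claim.\<close>
  define U where "U x = (\<integral>\<^sup>+t. ennreal (norm (\<psi>' t) / \<bar>t\<bar> powr dunkl_dim \<alpha> * norm (f' (x / t))) \<partial>lborel)" for x
  define h' where "h' x = (LINT t|lborel. hausdorff_integrand \<alpha> \<psi>' f' x t)" for x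
  have [measurable]: "U \<in> borel_measurable borel" unfolding U_def by measurable
  have h'[measurable]: "h' \<in> borel_measurable borel"
    unfolding h'_def hausdorff_integrand_def by measurable
  have hh': "AE x in lborel. dunkl_hausdorff \<alpha> \<psi> f x = h' x"
    using AE_lborel_singleton[of 0]
    by eventually_elim (simp add: h'_def dunkl_hausdorff_eq_borel(2)[OF f' _ ff' \<psi>\<psi>'])
  have h'_le: "ennreal (norm (h' x) powr p) \<le> ennreal_powr p (U x)" for x
    using norm_integral_powr_le_ennreal_powr[of p lborel "hausdorff_integrand \<alpha> \<psi>' f' x"] p
    by (simp add: h'_def U_def norm_hausdorff_integrand)
  \<comment> \<open>Kept general in \<open>K\<close> and \<open>M\<close>: one crude choice yields
    local finiteness, and arbitrary upper bounds later yield the sharp norm inequality.\<close>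
  have estimate: "(\<integral>\<^sup>+z. ennreal_powr p (U z) * dunkl_ball_kernel \<alpha> x r z \<partial>?m) \<le> ennreal ((M * K * \<phi> r) powr p * r powr dunkl_dim \<alpha>)"
    if MK: "0 < K" "0 < M" "hausdorff_K \<alpha> \<phi> \<psi> \<le> ennreal K" "dunkl_morrey_norm \<alpha> p \<phi> f \<le> ennreal M" and r: "0 < r"
    for K M x r
    unfolding U_def
  proof (rule hausdorff_ball_estimate[where \<phi>'=\<phi>'])
    show "(\<integral>\<^sup>+z. ennreal (norm (f' z) powr p) * dunkl_ball_kernel \<alpha> x r z \<partial>?m) \<le> ennreal ((M * \<phi> r) powr p * r powr dunkl_dim \<alpha>)"
      if "0 < r" for x r
      using MK that dunkl_morrey_norm_le_iff[OF \<alpha> p \<phi> f' ff' finf, where M=M] by simp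
    let ?I = "\<integral>\<^sup>+t. ennreal (norm (\<psi> t) / \<bar>t\<bar> powr dunkl_dim \<alpha> * \<phi> (r / \<bar>t\<bar>)) \<partial>lborel"
    have "ennreal (1 / \<phi> r) * ?I \<le> hausdorff_K \<alpha> \<phi> \<psi>"
      unfolding hausdorff_K_def using r by (intro SUP_upper2[where i=r]) (auto simp: nn_integral_completion)
    then have "ennreal (\<phi> r) * (ennreal (1 / \<phi> r) * ?I) \<le> ennreal (\<phi> r) * ennreal K"
      using MK by (intro mult_left_mono) (auto intro: order_trans)
    also have "ennreal (\<phi> r) * (ennreal (1 / \<phi> r) * ?I) = ?I"
      using \<phi>[OF r] by (simp add: mult.assoc[symmetric] ennreal_mult'[symmetric])
    also have "?I = (\<integral>\<^sup>+t. ennreal (norm (\<psi>' t) / \<bar>t\<bar> powr dunkl_dim \<alpha> * \<phi> (r / \<bar>t\<bar>)) \<partial>lborel)"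
      by (rule nn_integral_cong_AE, use \<psi>\<psi>' in eventually_elim) simp
    also have "ennreal (\<phi> r) * ennreal K = ennreal (K * \<phi> r)"
      using MK by (simp add: ennreal_mult' mult.commute)
    finally show "(\<integral>\<^sup>+t. ennreal (norm (\<psi>' t) / \<bar>t\<bar> powr dunkl_dim \<alpha> * \<phi> (r / \<bar>t\<bar>)) \<partial>lborel) \<le> ennreal (K * \<phi> r)" .
  qed (use MK r \<alpha> p \<phi> \<phi>\<phi>' in auto)
  \<comment> \<open>Adding 1 to the finite values makes both bounds strictly positive.\<close>
  obtain K M where KM: "0 < K" "0 < M" "hausdorff_K \<alpha> \<phi> \<psi> \<le> ennreal K" "dunkl_morrey_norm \<alpha> p \<phi> f \<le> ennreal M"
  proof
    show "0 < enn2real (hausdorff_K \<alpha> \<phi> \<psi>) + 1" "0 < enn2real (dunkl_morrey_norm \<alpha> p \<phi> f) + 1"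
      by (simp_all add: add_nonneg_pos)
    show "hausdorff_K \<alpha> \<phi> \<psi> \<le> ennreal (enn2real (hausdorff_K \<alpha> \<phi> \<psi>) + 1)"
      using assms(8) by (cases "hausdorff_K \<alpha> \<phi> \<psi>") (auto simp: ennreal_leI)
    show "dunkl_morrey_norm \<alpha> p \<phi> f \<le> ennreal (enn2real (dunkl_morrey_norm \<alpha> p \<phi> f) + 1)"
      using normf by (cases "dunkl_morrey_norm \<alpha> p \<phi> f") (auto simp: ennreal_leI)
  qed
  text \<open>The center \<open>x = 0\<close>, where the kernel is the indicator of the ball, controls \<open>U\<close> locally.\<close>
  have U_loc: "(\<integral>\<^sup>+z. ennreal_powr p (U z) * indicator (ball 0 R) z \<partial>?m) < \<infinity>" for R
  proof (cases "R > 0")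
    case True
    from le_less_trans[OF estimate[OF KM True, of 0] ennreal_less_top] show ?thesis
      by (simp add: dunkl_ball_kernel_def)
  qed simp
  \<comment> \<open>Needed before the norm of the image can be rewritten as weighted
    integrals.\<close>
  have finh: "dunkl_locally_finite \<alpha> (\<lambda>z. norm (h' z) powr p)"
    unfolding dunkl_locally_finite_def
  proof
    fix R :: real
    have "(\<integral>\<^sup>+z. ennreal (indicator (ball 0 R) z * norm (h' z) powr p) \<partial>?m)
        \<le> (\<integral>\<^sup>+z. ennreal_powr p (U z) * indicator (ball 0 R) z \<partial>?m)"
      using h'_le by (intro nn_integral_mono) (auto simp: indicator_def)
    also note U_loc
    finally show "(\<integral>\<^sup>+z. ennreal (indicator (ball 0 R) z * norm (h' z) powr p) \<partial>?m) < \<infinity>" .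
  qed
  have "AE x in lborel. U x \<noteq> \<infinity>"
  proof -
    \<comment> \<open>The balls with integer radius cover the line, so countably many null sets
      suffice.\<close>
    have "AE x in lborel. \<forall>n. ennreal_powr p (U x) * indicator (ball 0 (real n)) x \<noteq> \<infinity>"
      unfolding AE_all_countable AE_dunkl_borel_iff[OF \<alpha>1, symmetric]
      using U_loc by (intro allI nn_integral_PInf_AE) (auto simp: less_top[symmetric])
    then show ?thesis
    proof eventually_elim
      case (elim x)
      obtain n where "\<bar>x\<bar> < real n" using reals_Archimedean2 by blast
      then show ?case using elim[rule_format, of n] by (auto simp: ennreal_powr_def)
    qed
  qed
  then have "AE x in lborel. integrable lebesgue (hausdorff_integrand \<alpha> \<psi> f x)"
    using AE_lborel_singleton[of 0]
  proof eventually_elim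
    case (elim x)
    have ae: "AE t in lborel. hausdorff_integrand \<alpha> \<psi> f x t = hausdorff_integrand \<alpha> \<psi>' f' x t"
      using elim by (intro dunkl_hausdorff_eq_borel(1) ff' \<psi>\<psi>') auto
    have meas: "hausdorff_integrand \<alpha> \<psi> f x \<in> borel_measurable lebesgue"
      by (rule measurable_completion_AE[OF _ ae]) (simp add: hausdorff_integrand_def[abs_def])
    have "(\<integral>\<^sup>+t. ennreal (norm (hausdorff_integrand \<alpha> \<psi> f x t)) \<partial>lborel) = U x"
      unfolding U_def norm_hausdorff_integrand[symmetric]
      by (rule nn_integral_cong_AE, use ae in eventually_elim) simp
    then show ?case
      using elim meas by (simp add: integrable_iff_bounded nn_integral_completion less_top)
  qed
  then have "AE x in dunkl_measure \<alpha>. integrable lebesgue (hausdorff_integrand \<alpha> \<psi> f x)"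
    unfolding dunkl_measure_eq_completion[OF \<alpha>1] AE_completion_iff AE_dunkl_borel_iff[OF \<alpha>1] .
  moreover have norm_le: "dunkl_morrey_norm \<alpha> p \<phi> (dunkl_hausdorff \<alpha> \<psi> f) \<le> hausdorff_K \<alpha> \<phi> \<psi> * dunkl_morrey_norm \<alpha> p \<phi> f"
  proof (rule ennreal_le_mult_of_approx[OF assms(8) normf])
    fix K M :: real
    assume KM: "0 < K" "0 < M" "hausdorff_K \<alpha> \<phi> \<psi> \<le> ennreal K" "dunkl_morrey_norm \<alpha> p \<phi> f \<le> ennreal M"
    show "dunkl_morrey_norm \<alpha> p \<phi> (dunkl_hausdorff \<alpha> \<psi> f) \<le> ennreal (K * M)"
    proof (subst dunkl_morrey_norm_le_iff[OF \<alpha> p \<phi> h' hh' finh], safe)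
      fix x r :: real assume r: "0 < r"
      have "(\<integral>\<^sup>+z. ennreal (norm (h' z) powr p) * dunkl_ball_kernel \<alpha> x r z \<partial>?m)
          \<le> (\<integral>\<^sup>+z. ennreal_powr p (U z) * dunkl_ball_kernel \<alpha> x r z \<partial>?m)"
        using h'_le by (intro nn_integral_mono mult_right_mono) auto
      also note estimate[OF KM r]
      finally show "(\<integral>\<^sup>+z. ennreal (norm (h' z) powr p) * dunkl_ball_kernel \<alpha> x r z \<partial>?m)
          \<le> ennreal ((K * M * \<phi> r) powr p * r powr dunkl_dim \<alpha>)"
        by (simp add: mult.commute[of K])
    qed (use KM in simp)
  qed
  moreover have "dunkl_hausdorff \<alpha> \<psi> f \<in> dunkl_morrey \<alpha> p \<phi>"
    unfolding dunkl_morrey_def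
    using dunkl_locally_finite_imp_locally_integrable[OF \<alpha> h' hh' finh] assms(8) normf
    by (auto intro!: le_less_trans[OF norm_le] simp: ennreal_mult_less_top)
  ultimately show "(AE x in dunkl_measure \<alpha>. integrable lebesgue (hausdorff_integrand \<alpha> \<psi> f x)) \<and>
           dunkl_hausdorff \<alpha> \<psi> f \<in> dunkl_morrey \<alpha> p \<phi> \<and>
           dunkl_morrey_norm \<alpha> p \<phi> (dunkl_hausdorff \<alpha> \<psi> f)
             \<le> hausdorff_K \<alpha> \<phi> \<psi> * dunkl_morrey_norm \<alpha> p \<phi> f"
    by blast
qed

end
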